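(* The Morse index of $E_{\log}$ on $\mathrm{Conf}(3,5)$ at the critical point $C_i$, $i=0,1,2$, is equal to $2-i$.
   Context: $\mathbb{S}^{2}$ is the unit sphere in $\mathbb{R}^3$. $\mathrm{Conf}(3,5)=(\mathbb{S}^2\times\dots\times\mathbb{S}^2)/SO(3)$ (five factors) is the configuration space of $5$-tuples of points in $\mathbb{S}^2$ up to isometry, of dimension $7$. For five distinct points, $E_{\log}(X)=\sum_{1\le i\ne j\le 5}\log\frac{1}{|x_i-x_j|}$, which is invariant under rotations and so defines a smooth function near any class of tuples of distinct points in $\mathrm{Conf}(3,5)$. The following are critical points of $E_{\log}$ on $\mathrm{Conf}(3,5)$: - $C_0$ (type $(0,5)$): the five vertices of a regular pentagon inscribed in a great circle; - $C_1$ (type $(1,2,2)$): the square pyramid consisting of the point $(0,0,1)$ and four points at height $-1/4$ forming a square, i.e. $(\pm\sqrt{15}/4,0,-1/4)$ and $(0,\pm\sqrt{15}/4,-1/4)$; - $C_2$ (type $(2,3)$): the triangular bi-pyramid consisting of two antipodal points $(0,0,\pm1)$ and the three vertices of an equilateral triangle inscribed in the equator. The Morse index of a critical point $x$ of a smooth function $f$ on a manifold is the negative index of inertia (number of negative eigenvalues, with multiplicity) of the Hessian of $f$ at $x$. *)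

theory Defs
  imports "HOL-Analysis.Analysis"
begin

section \<open>Smooth maps and the negative index of inertia of a Hessian\<close>

text \<open>For an open set \<open>S\<close> in a finite-dimensional space, \<open>Ck_on k S f\<close> says that \<open>f\<close> is \<open>k\<close> times
  continuously differentiable on \<open>S\<close>.\<close>

primrec Ck_on :: "nat \<Rightarrow> 'a::euclidean_space set \<Rightarrow> ('a \<Rightarrow> 'b::euclidean_space) \<Rightarrow> bool" where
  "Ck_on 0 S f \<longleftrightarrow> continuous_on S f"
| "Ck_on (Suc k) S f \<longleftrightarrow>
     (\<forall>x\<in>S. f differentiable (at x)) \<and>
     (\<forall>v. Ck_on k S (\<lambda>x. frechet_derivative f (at x) v))"

definition smooth_on :: "'a::euclidean_space set \<Rightarrow> ('a \<Rightarrow> 'b::euclidean_space) \<Rightarrow> bool" where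
  "smooth_on S f \<longleftrightarrow> (\<forall>k. Ck_on k S f)"

definition hessian :: "(real^'n \<Rightarrow> real) \<Rightarrow> real^'n \<Rightarrow> real^'n^'n" where
  "hessian g u =
     (\<chi> i j. frechet_derivative (\<lambda>x. frechet_derivative g (at x) (axis j 1)) (at u) (axis i 1))"

text \<open>The number of negative eigenvalues, each counted with the dimension of its eigenspace; for a
  symmetric matrix (such as a Hessian) this is also the algebraic multiplicity.\<close>

definition neg_index :: "real^'n^'n \<Rightarrow> nat" where
  "neg_index A =
     (\<Sum>c | c < 0 \<and> (\<exists>v. v \<noteq> 0 \<and> A *v v = c *\<^sub>R v). dim {v. A *v v = c *\<^sub>R v})"

section \<open>The configuration space of five points on the sphere\<close>

definition sphere_tuples :: "(real^3^5) set" where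
  "sphere_tuples = {X. \<forall>i. norm (X $ i) = 1}"

definition act :: "real^3^3 \<Rightarrow> real^3^5 \<Rightarrow> real^3^5" where
  "act A X = (\<chi> i. A *v (X $ i))"

definition rotation_rel :: "((real^3^5) \<times> (real^3^5)) set" where
  "rotation_rel = {(X, Y). X \<in> sphere_tuples \<and> Y \<in> sphere_tuples \<and>
                           (\<exists>Q. rotation_matrix Q \<and> Y = act Q X)}"

definition Conf :: "(real^3^5) set set" where
  "Conf = sphere_tuples // rotation_rel"

definition conf_class :: "real^3^5 \<Rightarrow> (real^3^5) set" where
  "conf_class X = rotation_rel `` {X}"

text \<open>Smooth local parametrizations of the quotient manifold \<open>Conf\<close>.  The quotient structure (the
  one for which \<open>conf_class\<close> is a smooth submersion, at tuples where the action is free) has as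
  parametrizations the maps \<open>\<lambda>u. conf_class (\<phi> u)\<close> for slices \<open>\<phi>\<close>: smooth families
  of tuples, indexed by an open subset of \<open>\<real>\<^sup>7\<close>, meeting every rotation orbit at most once and
  transversally.  Skew-symmetric matrices form the Lie algebra of the rotation group and
  \<open>act A X\<close>, for skew \<open>A\<close>, runs over the tangent space of the orbit of \<open>X\<close>.  The last condition
  says that \<open>(h, A) \<mapsto> D\<phi>(u) h - act A (\<phi> u)\<close> is injective; since \<open>7 + 3 = 10\<close> it is then an
  isomorphism onto the tangent space of the product of spheres, that is, \<open>(Q, u) \<mapsto> act Q (\<phi> u)\<close>
  is a local diffeomorphism.\<close>

definition conf_param :: "(real^7) set \<Rightarrow> (real^7 \<Rightarrow> real^3^5) \<Rightarrow> bool" where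
  "conf_param U \<phi> \<longleftrightarrow>
     open U \<and> smooth_on U \<phi> \<and> \<phi> ` U \<subseteq> sphere_tuples \<and>
     inj_on (\<lambda>u. conf_class (\<phi> u)) U \<and>
     (\<forall>u\<in>U. \<forall>h A. transpose A = - A \<longrightarrow>
        frechet_derivative \<phi> (at u) h = act A (\<phi> u) \<longrightarrow> h = 0 \<and> A = 0)"

text \<open>\<open>p\<close> is a critical point of \<open>f\<close>, \<open>f\<close> is smooth near \<open>p\<close>, and the Hessian of \<open>f\<close> at \<open>p\<close> in
  local coordinates (which exist around \<open>p\<close>, and may be chosen arbitrarily) has exactly \<open>m\<close>
  negative eigenvalues.\<close>

definition has_morse_index :: "((real^3^5) set \<Rightarrow> real) \<Rightarrow> (real^3^5) set \<Rightarrow> nat \<Rightarrow> bool" where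
  "has_morse_index f p m \<longleftrightarrow>
     p \<in> Conf \<and>
     (\<exists>U \<phi> u. conf_param U \<phi> \<and> u \<in> U \<and> conf_class (\<phi> u) = p) \<and>
     (\<forall>U \<phi> u. conf_param U \<phi> \<and> u \<in> U \<and> conf_class (\<phi> u) = p \<longrightarrow>
        (let g = (\<lambda>w. f (conf_class (\<phi> w))) in
           (\<exists>W. open W \<and> u \<in> W \<and> smooth_on W g) \<and>
           (g has_derivative (\<lambda>_. 0)) (at u) \<and>
           neg_index (hessian g u) = m))"

section \<open>Logarithmic energy and its critical configurations\<close>

definition E_log :: "real^3^5 \<Rightarrow> real" where
  "E_log X = (\<Sum>i\<in>UNIV. \<Sum>j\<in>UNIV - {i}. ln (1 / norm (X $ i - X $ j)))"

text \<open>The common value of \<open>E_log\<close> on the tuples in a class.\<close>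

definition E_log_conf :: "(real^3^5) set \<Rightarrow> real" where
  "E_log_conf p = the_elem (E_log ` p)"

text \<open>A tuple has the given type if its entries enumerate the described five-point set, in any
  order.\<close>

definition is_C0 :: "real^3^5 \<Rightarrow> bool" where
  "is_C0 X \<longleftrightarrow> (\<exists>a b. norm a = 1 \<and> norm b = 1 \<and> a \<bullet> b = 0 \<and>
     range (\<lambda>i. X $ i) =
       (\<lambda>k::nat. cos (2 * pi * real k / 5) *\<^sub>R a + sin (2 * pi * real k / 5) *\<^sub>R b) ` {..<5})"

definition is_C1 :: "real^3^5 \<Rightarrow> bool" where
  "is_C1 X \<longleftrightarrow> range (\<lambda>i. X $ i) =
     {vector [0, 0, 1],
      vector [sqrt 15 / 4, 0, - 1 / 4], vector [- sqrt 15 / 4, 0, - 1 / 4],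
      vector [0, sqrt 15 / 4, - 1 / 4], vector [0, - sqrt 15 / 4, - 1 / 4]}"

definition is_C2 :: "real^3^5 \<Rightarrow> bool" where
  "is_C2 X \<longleftrightarrow> (\<exists>t. range (\<lambda>i. X $ i) =
     {vector [0, 0, 1], vector [0, 0, - 1]} \<union>
     (\<lambda>k::nat. vector [cos (t + 2 * pi * real k / 3), sin (t + 2 * pi * real k / 3), 0]) ` {..<3})"

end

theory Submission
  imports Defs
begin

text \<open>
  Near a tuple \<open>X\<close> of distinct points the function to be studied is
  \<open>E = -1/2 \<Sum> ln |x\<^sub>i - x\<^sub>j|\<^sup>2\<close>, read in a chart \<open>\<phi>\<close> of the quotient.  Since the energy is invariant
  under rotations, a chart through the class of \<open>X\<close> may be rotated so that it passes through \<open>X\<close>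
  itself.  The gradient of \<open>E\<close> along the spheres vanishes when
  \<open>\<Sum>\<^sub>j (x\<^sub>i - x\<^sub>j) / |x\<^sub>i - x\<^sub>j|\<^sup>2 = 2 x\<^sub>i\<close> for every \<open>i\<close> (\<open>stationary\<close>); the factor \<open>2\<close> is forced,
  because each of the four summands has inner product \<open>1/2\<close> with \<open>x\<^sub>i\<close>.  Given this equation, the
  second derivatives of \<open>\<phi>\<close> enter the Hessian of \<open>E \<circ> \<phi>\<close> only through \<open>x\<^sub>i \<bullet> \<partial>\<^sup>2\<phi>\<^sub>i\<close>, which the
  relation \<open>|\<phi>\<^sub>i| = 1\<close> expresses by first derivatives.  So the Hessian is the pullback under \<open>D\<phi>\<close> of
  an explicit quadratic form \<open>hess_form X\<close> (\<open>energy_second_variation\<close>).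

  Velocities of rotations lie in the radical of this form, and together with the image of \<open>D\<phi>\<close> they
  span the ten-dimensional tangent space of the product of spheres.  Hence the index of the Hessian
  is the index of \<open>hess_form X\<close> on that tangent space.  For a symmetric matrix the number of negative
  eigenvalues is \<open>m\<close> as soon as the form is negative definite on a space of dimension \<open>m\<close> and
  nonnegative on the kernel of a linear map of rank at most \<open>m\<close> (\<open>neg_index_eq\<close>); this yields
  \<open>has_morse_index_criterion\<close>.  Charts exist because fixing one point and
  confining a second one to a half-plane bounded by the axis through it removes the rotations (\<open>exists_chart\<close>).

  What remains is to diagonalise \<open>hess_form X\<close> for the three configurations, where symmetry does most
  of the work.  The displacement of a point other than a pole splits into a part along its horizontal
  circle and a part across it.

  \<^item> Pentagon: along the great circle the form is \<open>\<Sum> (\<alpha>\<^sub>i - \<alpha>\<^sub>j)\<^sup>2 / |x\<^sub>i - x\<^sub>j|\<^sup>2\<close>; across it the form is a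
    circulant one whose Fourier mode \<open>k\<close> has eigenvalue \<open>4 - k (5 - k)\<close>, that is \<open>4, 0, -2, -2, 0\<close>.
    The modes \<open>2\<close> and \<open>3\<close> make up the two negative directions.
  \<^item> Square pyramid: the form is a sum of squares except for a negative multiple of
    \<open>(\<beta>\<^sub>1 - \<beta>\<^sub>2 + \<beta>\<^sub>3 - \<beta>\<^sub>4)\<^sup>2\<close>, where \<open>\<beta>\<^sub>k\<close> measures the vertical motion of the \<open>k\<close>-th base point.  The negative
    direction lifts one diagonal of the base and lowers the other.
  \<^item> Triangular bipyramid: the form is a sum of squares.
\<close>

section \<open>Calculus of smooth maps\<close>

lemma Ck_on_cong:
  fixes f g :: "'a::euclidean_space \<Rightarrow> 'b::euclidean_space"
  assumes "open S" "\<And>x. x \<in> S \<Longrightarrow> f x = g x" "Ck_on k S f"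
  shows "Ck_on k S g"
  using assms(2,3)
proof (induction k arbitrary: f g)
  case 0
  then show ?case by (simp cong: continuous_on_cong)
next
  case (Suc k)
  have der: "(g has_derivative frechet_derivative f (at x)) (at x)" if "x \<in> S" for x
    using Suc.prems that \<open>open S\<close>
    by (metis Ck_on.simps(2) frechet_derivative_works has_derivative_transform_within_open)
  have "Ck_on k S (\<lambda>x. frechet_derivative g (at x) v)" for v
    by (rule Suc.IH[of "\<lambda>x. frechet_derivative f (at x) v"])
      (use der Suc.prems in \<open>auto simp: frechet_derivative_at[OF der, symmetric]\<close>)
  then show ?case using der by (auto simp: differentiable_def)
qed

text \<open>Derivatives may be supplied in closed form, so that the closure properties below become inductions
  in which the derivative is again built from functions of the same kind.\<close>

lemma Ck_on_SucI:
  fixes f :: "'a::euclidean_space \<Rightarrow> 'b::euclidean_space"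
  assumes "open S" "\<And>x. x \<in> S \<Longrightarrow> (f has_derivative f' x) (at x)"
    and "\<And>v. Ck_on k S (\<lambda>x. f' x v)"
  shows "Ck_on (Suc k) S f"
proof -
  have "Ck_on k S (\<lambda>x. frechet_derivative f (at x) v)" for v
    by (rule Ck_on_cong[OF assms(1) _ assms(3)[of v]]) (metis assms(2) frechet_derivative_at)
  then show ?thesis using assms(2) by (auto simp: differentiable_def)
qed

lemma Ck_on_subset: "Ck_on k S f \<Longrightarrow> T \<subseteq> S \<Longrightarrow> Ck_on k T f"
  by (induction k arbitrary: f) (auto intro: continuous_on_subset)

lemma Ck_on_SucD:
  assumes "Ck_on (Suc k) S f"
  shows "Ck_on k S f"
  using assms
proof (induction k arbitrary: f)
  case 0
  then show ?case
    by (auto intro!: continuous_at_imp_continuous_on differentiable_imp_continuous_within)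
next
  case (Suc k)
  from Suc.prems have d: "\<forall>x\<in>S. f differentiable (at x)"
    and c: "\<And>v. Ck_on (Suc k) S (\<lambda>x. frechet_derivative f (at x) v)"
    by simp_all
  from d Suc.IH[OF c] show ?case by simp
qed

lemma Ck_on_has_derivative:
  assumes "Ck_on (Suc k) S f" "x \<in> S"
  shows "(f has_derivative frechet_derivative f (at x)) (at x)"
  using assms by (simp add: frechet_derivative_works)

lemma Ck_on_frechet_derivative:
  "Ck_on (Suc k) S f \<Longrightarrow> Ck_on k S (\<lambda>x. frechet_derivative f (at x) v)"
  by simp

(* Unfolding the recursion would split every smoothness hypothesis into statements about derivatives. *)
declare Ck_on.simps(2) [simp del]

lemma Ck_on_const: "open S \<Longrightarrow> Ck_on k S (\<lambda>_. c)"
  by (induction k arbitrary: c) (simp_all add: Ck_on.simps(2))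

lemma Ck_on_ident: "open S \<Longrightarrow> Ck_on k S (\<lambda>x. x)"
  by (cases k) (auto intro!: Ck_on_SucI[of _ _ "\<lambda>_ v. v"] Ck_on_const)

lemma Ck_on_add:
  fixes f g :: "'a::euclidean_space \<Rightarrow> 'b::euclidean_space"
  assumes "open S" "Ck_on k S f" "Ck_on k S g"
  shows "Ck_on k S (\<lambda>x. f x + g x)"
  using assms(2,3)
proof (induction k arbitrary: f g)
  case 0
  then show ?case by (simp add: continuous_on_add)
next
  case (Suc k)
  show ?case
    by (rule Ck_on_SucI[OF assms(1)])
      (use Suc in \<open>auto intro!: has_derivative_add Ck_on_has_derivative Ck_on_frechet_derivative\<close>)
qed

lemma Ck_on_linear:
  fixes f :: "'a::euclidean_space \<Rightarrow> 'b::euclidean_space"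
    and L :: "'b \<Rightarrow> 'c::euclidean_space"
  assumes "open S" "linear L" "Ck_on k S f"
  shows "Ck_on k S (\<lambda>x. L (f x))"
  using assms(3)
proof (induction k arbitrary: f)
  case 0
  then show ?case
    using assms(2) by (simp add: linear_continuous_on_compose)
next
  case (Suc k)
  have "((\<lambda>x. L (f x)) has_derivative (\<lambda>v. L (frechet_derivative f (at x) v))) (at x)"
    if "x \<in> S" for x
    by (rule linear_imp_has_derivative[OF assms(2), THEN has_derivative_compose[rotated],
        OF Ck_on_has_derivative[OF Suc.prems that]])
  then show ?case
    by (rule Ck_on_SucI[OF assms(1)]) (use Suc in \<open>auto intro: Ck_on_frechet_derivative\<close>)
qed

lemma Ck_on_bilinear:
  fixes f :: "'a::euclidean_space \<Rightarrow> 'b::euclidean_space"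
    and g :: "'a \<Rightarrow> 'c::euclidean_space" and p :: "'b \<Rightarrow> 'c \<Rightarrow> 'd::euclidean_space"
  assumes "open S" "bounded_bilinear p" "Ck_on k S f" "Ck_on k S g"
  shows "Ck_on k S (\<lambda>x. p (f x) (g x))"
  using assms(3,4)
proof (induction k arbitrary: f g)
  case 0
  then show ?case
    using bounded_bilinear.continuous_on[OF assms(2)] by auto
next
  case (Suc k)
  have "Ck_on k S (\<lambda>x. p (f x) (frechet_derivative g (at x) v)
                     + p (frechet_derivative f (at x) v) (g x))" for v
    using Suc.prems by (intro Ck_on_add[OF assms(1)] Suc.IH) (auto intro: Ck_on_SucD Ck_on_frechet_derivative)
  then show ?case
    using Suc.prems
    by (intro Ck_on_SucI[OF assms(1) bounded_bilinear.FDERIV[OF assms(2)]])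
      (auto intro: Ck_on_has_derivative)
qed

lemma Ck_on_sum:
  fixes f :: "'i \<Rightarrow> 'a::euclidean_space \<Rightarrow> 'b::euclidean_space"
  assumes "open S" "\<And>i. i \<in> I \<Longrightarrow> Ck_on k S (f i)"
  shows "Ck_on k S (\<lambda>x. \<Sum>i\<in>I. f i x)"
  using assms(2)
  by (induction I rule: infinite_finite_induct) (auto intro!: Ck_on_const Ck_on_add assms(1))

text \<open>The derivative of \<open>1/f\<close> is a polynomial in \<open>1/f\<close> and a derivative of \<open>f\<close>, so one more order of
  smoothness follows from the previous one.\<close>

lemma Ck_on_inverse:
  fixes f :: "'a::euclidean_space \<Rightarrow> real"
  assumes "open S" "Ck_on k S f" "\<And>x. x \<in> S \<Longrightarrow> f x \<noteq> 0"
  shows "Ck_on k S (\<lambda>x. inverse (f x))"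
  using assms(2)
proof (induction k)
  case 0
  then show ?case using assms(3) by (auto intro: continuous_on_inverse)
next
  case (Suc k)
  have "Ck_on k S (\<lambda>x. - (inverse (f x) * frechet_derivative f (at x) v * inverse (f x)))" for v
    using Suc by (intro Ck_on_linear[OF assms(1), of uminus] Ck_on_bilinear[OF assms(1) bounded_bilinear_mult])
      (auto intro: Ck_on_SucD Ck_on_frechet_derivative simp: linear_iff)
  then show ?case
    using assms(3)
    by (intro Ck_on_SucI[OF assms(1) Deriv.has_derivative_inverse])
      (use Suc.prems in \<open>auto intro: Ck_on_has_derivative\<close>)
qed

lemma Ck_on_ln:
  fixes f :: "'a::euclidean_space \<Rightarrow> real"
  assumes "open S" "Ck_on k S f" "\<And>x. x \<in> S \<Longrightarrow> f x > 0"
  shows "Ck_on k S (\<lambda>x. ln (f x))"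
proof (cases k)
  case 0
  then show ?thesis using assms by (auto intro!: continuous_on_ln) (metis less_irrefl)
next
  case (Suc l)
  have "((\<lambda>x. ln (f x)) has_derivative (\<lambda>v. inverse (f x) * frechet_derivative f (at x) v)) (at x)"
    if "x \<in> S" for x
    using assms(2,3) that unfolding Suc
    by (auto intro!: derivative_eq_intros Ck_on_has_derivative simp: field_simps)
  moreover have "Ck_on l S (\<lambda>x. inverse (f x) * frechet_derivative f (at x) v)" for v
    using assms Suc
    by (intro Ck_on_bilinear[OF assms(1) bounded_bilinear_mult] Ck_on_inverse)
      (auto intro: Ck_on_SucD Ck_on_frechet_derivative simp: less_le)
  ultimately show ?thesis unfolding Suc by (rule Ck_on_SucI[OF assms(1)])
qed

text \<open>With \<open>r = 1/sqrt f\<close> the derivative is \<open>- r\<^sup>3 f' / 2\<close>, again a polynomial in \<open>r\<close>.  Taking the reciprocal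
  root as the basic function makes the induction close up; it is what normalising a vector needs.\<close>

lemma Ck_on_inverse_sqrt:
  fixes f :: "'a::euclidean_space \<Rightarrow> real"
  assumes "open S" "Ck_on k S f" "\<And>x. x \<in> S \<Longrightarrow> f x > 0"
  shows "Ck_on k S (\<lambda>x. inverse (sqrt (f x)))"
  using assms(2)
proof (induction k)
  case 0
  then show ?case using assms(3)
    by (auto intro!: continuous_on_inverse continuous_on_real_sqrt) (metis less_irrefl)
next
  case (Suc k)
  let ?r = "\<lambda>x. inverse (sqrt (f x))"
  have "((\<lambda>x. ?r x) has_derivative
      (\<lambda>v. - ((1/2) *\<^sub>R (?r x * ?r x * ?r x * frechet_derivative f (at x) v)))) (at x)"
    if "x \<in> S" for x
    using Suc.prems assms(3)[OF that] that
    by (auto intro!: derivative_eq_intros Ck_on_has_derivative simp: field_simps)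
  moreover have "Ck_on k S (\<lambda>x. - ((1/2) *\<^sub>R (?r x * ?r x * ?r x * frechet_derivative f (at x) v)))" for v
    using Suc
    by (intro Ck_on_linear[OF assms(1), of "\<lambda>y. - ((1/2) *\<^sub>R y)"]
        Ck_on_bilinear[OF assms(1) bounded_bilinear_mult])
      (auto intro: Ck_on_SucD Ck_on_frechet_derivative simp: linear_iff algebra_simps)
  ultimately show ?case by (rule Ck_on_SucI[OF assms(1)])
qed

lemma smooth_on_has_derivative:
  assumes "smooth_on S f" "x \<in> S"
  shows "(f has_derivative frechet_derivative f (at x)) (at x)"
  using assms Ck_on_has_derivative unfolding smooth_on_def by blast

lemma smooth_on_frechet_derivative:
  assumes "smooth_on S f"
  shows "smooth_on S (\<lambda>x. frechet_derivative f (at x) v)"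
  using assms Ck_on_frechet_derivative unfolding smooth_on_def by blast

section \<open>The negative index of inertia of a symmetric matrix\<close>

lemma symmetric_matrix_inner:
  fixes A :: "real^'n^'n"
  assumes "transpose A = A"
  shows "x \<bullet> (A *v y) = (A *v x) \<bullet> y"
  by (metis assms dot_lmul_matrix vector_transpose_matrix)

text \<open>Minimise the Rayleigh quotient on the unit sphere of the invariant subspace: the minimum \<open>c\<close> is
  negative, and the first variation at a minimiser \<open>v\<close> shows that \<open>A v - c v\<close>, which stays in the
  subspace, vanishes.\<close>

lemma negative_form_imp_eigenvector:
  fixes A :: "real^'n^'n"
  assumes sym: "transpose A = A" and V: "subspace V" and inv: "\<And>x. x \<in> V \<Longrightarrow> A *v x \<in> V"
    and x: "x \<in> V" "x \<bullet> (A *v x) < 0"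
  obtains c v where "c < 0" "v \<in> V" "v \<noteq> 0" "A *v v = c *\<^sub>R v"
proof -
  let ?K = "V \<inter> sphere 0 1"
  have nx: "x \<noteq> 0" using x by auto
  have "x /\<^sub>R norm x \<in> ?K" using x(1) V nx by (auto simp: subspace_scale)
  then have "?K \<noteq> {}" by blast
  moreover have "compact ?K" using V by (simp add: closed_Int_compact closed_subspace)
  moreover have "continuous_on ?K (\<lambda>x. x \<bullet> (A *v x))"
    by (intro continuous_intros linear_continuous_on_compose matrix_vector_mul_linear)
  ultimately obtain v where v: "v \<in> ?K" and min: "\<And>y. y \<in> ?K \<Longrightarrow> v \<bullet> (A *v v) \<le> y \<bullet> (A *v y)"
    using continuous_attains_inf[of ?K "\<lambda>x. x \<bullet> (A *v x)"] by blast
  define c where "c = v \<bullet> (A *v v)"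
  have vV: "v \<in> V" and v1: "v \<bullet> v = 1" using v by (auto simp: dot_square_norm)
  have low: "y \<bullet> (A *v y) - c * (y \<bullet> y) \<ge> 0" if "y \<in> V" for y
  proof (cases "y = 0")
    case False
    have "y /\<^sub>R norm y \<in> ?K" using that V False by (auto simp: subspace_scale)
    from min[OF this] have "c \<le> (y \<bullet> (A *v y)) / (norm y)\<^sup>2"
      by (simp add: c_def matrix_vector_mult_scaleR power2_eq_square field_simps)
    then show ?thesis using False by (simp add: field_simps power2_norm_eq_inner)
  qed simp
  have "c \<le> (x \<bullet> (A *v x)) / (x \<bullet> x)" using low[OF x(1)] nx by (simp add: field_simps)
  also have "\<dots> < 0" using x(2) nx by (simp add: divide_neg_pos)
  finally have "c < 0" .
  define w where "w = A *v v - c *\<^sub>R v"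
  define r where "r = w \<bullet> (A *v w) - c * (w \<bullet> w)"
  have wV: "w \<in> V" unfolding w_def using vV inv V by (simp add: subspace_diff subspace_scale)
  then have r0: "r \<ge> 0" using low r_def by blast
  \<comment> \<open>the first variation of the Rayleigh quotient at its minimum in the direction \<open>w\<close>\<close>
  have expand: "2 * t * (w \<bullet> w) + t\<^sup>2 * r \<ge> 0" for t
  proof -
    have "(v + t *\<^sub>R w) \<bullet> (A *v (v + t *\<^sub>R w)) - c * ((v + t *\<^sub>R w) \<bullet> (v + t *\<^sub>R w))
        = (c - c * (v \<bullet> v)) + 2 * t * (w \<bullet> (A *v v) - c * (w \<bullet> v)) + t\<^sup>2 * r"
      using symmetric_matrix_inner[OF sym, of v w]
      by (simp add: r_def c_def inner_simps
          power2_eq_square inner_commute algebra_simps)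
    moreover have "w \<bullet> (A *v v) - c * (w \<bullet> v) = w \<bullet> w" by (simp add: w_def inner_simps)
    ultimately show ?thesis
      using low[of "v + t *\<^sub>R w"] vV wV V v1 by (simp add: subspace_add subspace_scale)
  qed
  have "w \<bullet> w = 0"
  proof (rule ccontr)
    assume "w \<bullet> w \<noteq> 0"
    then have p: "(w \<bullet> w)\<^sup>2 > 0" by simp
    define a where "a = w \<bullet> w"
    have "2 * (- a / (r + 1)) * a + (- a / (r + 1))\<^sup>2 * r = - (a\<^sup>2 * (r + 2)) / (r + 1)\<^sup>2"
      using r0 by (simp add: divide_simps power2_eq_square) (simp add: algebra_simps)
    also have "\<dots> < 0" using p r0 a_def by (simp add: divide_neg_pos)
    finally show False using expand[of "- a / (r + 1)"] a_def by simp
  qed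
  then have "A *v v = c *\<^sub>R v" by (simp add: w_def)
  then show thesis using that \<open>c < 0\<close> vV v1 by fastforce
qed

text \<open>Eigenspaces of a symmetric matrix are mutually orthogonal, so orthogonal bases of those with negative
  eigenvalue unite to an independent set, whose cardinality is the sum of the dimensions.\<close>

lemma neg_index_basis:
  fixes A :: "real^'n^'n"
  assumes sym: "transpose A = A"
  obtains B where "pairwise orthogonal B" "0 \<notin> B" "card B = neg_index A" "finite B"
    "\<And>b. b \<in> B \<Longrightarrow> \<exists>c<0. A *v b = c *\<^sub>R b"
    "\<And>c v. c < 0 \<Longrightarrow> A *v v = c *\<^sub>R v \<Longrightarrow> v \<in> span B"
proof -
  define E where "E c = {v. A *v v = c *\<^sub>R v}" for c
  define Lam where "Lam = {c. c < 0 \<and> (\<exists>v. v \<noteq> 0 \<and> A *v v = c *\<^sub>R v)}"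
  have subE: "subspace (E c)" for c
    by (auto simp: E_def subspace_def algebra_simps)
  have "\<exists>B. 0 \<notin> B \<and> B \<subseteq> E c \<and> pairwise orthogonal B \<and> independent B \<and> card B = dim (E c) \<and> span B = E c" for c
    using orthogonal_basis_subspace[OF subE, of c] dependent_zero by metis
  then obtain B where B: "\<And>c. 0 \<notin> B c" "\<And>c. B c \<subseteq> E c" "\<And>c. pairwise orthogonal (B c)"
    "\<And>c. independent (B c)" "\<And>c. card (B c) = dim (E c)" "\<And>c. span (B c) = E c"
    by metis
  have orthE: "orthogonal x y" if "x \<in> E c" "y \<in> E d" "c \<noteq> d" for x y c d
  proof -
    have "d * (x \<bullet> y) = c * (x \<bullet> y)"
      using symmetric_matrix_inner[OF sym, of x y] that by (simp add: E_def)
    then show ?thesis using that by (simp add: orthogonal_def)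
  qed
  let ?B = "\<Union>c\<in>Lam. B c"
  have po: "pairwise orthogonal ?B"
    using B(2,3) orthE unfolding pairwise_def by (metis UN_iff subsetD)
  have ind: "independent ?B" using po B(1) by (intro pairwise_orthogonal_independent) auto
  then have fin: "finite ?B" by (simp add: independent_imp_finite)
  have disj: "B c \<inter> B d = {}" if "c \<noteq> d" for c d
  proof -
    have "x = 0" if "x \<in> B c" "x \<in> B d" for x
      using orthE[of x c x d] \<open>c \<noteq> d\<close> that B(2)[of c] B(2)[of d]
      by (metis orthogonal_self subsetD)
    then show ?thesis using B(1) by blast
  qed
  have ne: "B c \<noteq> {}" if "c \<in> Lam" for c
  proof
    assume "B c = {}"
    then have "E c = {0}" using B(6)[of c] by simp
    then show False using that unfolding Lam_def E_def by blast
  qed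
  have "finite Lam"
  proof -
    obtain e where e: "\<And>c. c \<in> Lam \<Longrightarrow> e c \<in> B c" using ne by (meson ex_in_conv)
    have "inj_on e Lam"
    proof (rule inj_onI)
      fix c d assume "c \<in> Lam" "d \<in> Lam" "e c = e d"
      then have "e c \<in> B c \<inter> B d" using e[of c] e[of d] by simp
      then show "c = d" using disj[of c d] by blast
    qed
    moreover have "e ` Lam \<subseteq> ?B" using e by blast
    ultimately show ?thesis using fin by (rule inj_on_finite)
  qed
  then have "card ?B = (\<Sum>c\<in>Lam. card (B c))"
    using disj B(4) by (intro card_UN_disjoint) (auto simp: independent_imp_finite)
  then have card: "card ?B = neg_index A"
    by (simp add: neg_index_def Lam_def B(5) E_def)
  show thesis
  proof (rule that[OF po _ card fin])
    show "0 \<notin> ?B" using B(1) by blast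
    show "\<exists>c<0. A *v b = c *\<^sub>R b" if "b \<in> ?B" for b
      using that B(2) unfolding E_def Lam_def by blast
    show "v \<in> span ?B" if "c < 0" "A *v v = c *\<^sub>R v" for c v
    proof (cases "v = 0")
      case False
      then have "c \<in> Lam" "v \<in> span (B c)" using that B(6) by (auto simp: Lam_def E_def)
      then show ?thesis by (meson UN_upper span_mono subsetD)
    qed (simp add: span_zero)
  qed
qed

text \<open>A form of Sylvester's law of inertia.  Let \<open>N\<close> be the span of the eigenvectors with negative eigenvalue.
  The form is negative definite on \<open>N\<close> and, as an eigenvector in the orthogonal complement would
  already lie in \<open>N\<close>, nonnegative on the complement.  So \<open>L\<close> is injective on \<open>N\<close>, and the image of \<open>S\<close> under \<open>J\<close>
  meets the complement of \<open>N\<close> only in \<open>0\<close>.\<close>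

lemma neg_index_eq:
  fixes A :: "real^'n^'n" and L :: "real^'n \<Rightarrow> 'b::euclidean_space"
  assumes sym: "transpose A = A" and S: "subspace S"
    and L: "linear L" "range L \<subseteq> S" "\<And>h. L h = 0 \<Longrightarrow> h \<bullet> (A *v h) \<ge> 0"
    and J: "linear J" "\<And>y. y \<in> S \<Longrightarrow> y \<noteq> 0 \<Longrightarrow> J y \<bullet> (A *v J y) < 0"
  shows "neg_index A = dim S"
proof -
  obtain B where B: "pairwise orthogonal B" "0 \<notin> B" "card B = neg_index A" "finite B"
    and eig: "\<And>b. b \<in> B \<Longrightarrow> \<exists>c<0. A *v b = c *\<^sub>R b"
    and all: "\<And>c v. c < 0 \<Longrightarrow> A *v v = c *\<^sub>R v \<Longrightarrow> v \<in> span B"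
    using neg_index_basis[OF sym] by metis
  define P where "P = {y. \<forall>x\<in>span B. orthogonal x y}"
  have dimN: "dim (span B) = neg_index A"
    using B(1-3) by (metis dim_span_eq_card_independent pairwise_orthogonal_independent)
  from eig obtain e where e: "\<And>b. b \<in> B \<Longrightarrow> e b < 0" "\<And>b. b \<in> B \<Longrightarrow> A *v b = e b *\<^sub>R b"
    by metis
  have neg: "x \<bullet> (A *v x) < 0" if x: "x \<in> span B" "x \<noteq> 0" for x
  proof -
    obtain u where u: "x = (\<Sum>b\<in>B. u b *\<^sub>R b)"
      using x(1) B(4) by (auto simp: span_finite)
    have xb: "x \<bullet> b = u b * (b \<bullet> b)" if "b \<in> B" for b
    proof -
      have "x \<bullet> b = (\<Sum>a\<in>B. if a = b then u b * (b \<bullet> b) else 0)"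
        unfolding u inner_sum_left using B(1) that
        by (intro sum.cong) (auto simp: pairwise_def orthogonal_def)
      then show ?thesis using that B(4) by simp
    qed
    have "A *v x = (\<Sum>b\<in>B. (u b * e b) *\<^sub>R b)"
      unfolding u using e(2)
      by (simp add: linear_sum[OF matrix_vector_mul_linear] matrix_vector_mult_scaleR)
    then have eq: "x \<bullet> (A *v x) = (\<Sum>b\<in>B. e b * ((u b)\<^sup>2 * (b \<bullet> b)))"
      using xb by (simp add: inner_sum_right power2_eq_square mult_ac)
    obtain b where "b \<in> B" "u b \<noteq> 0" using x(2) u by (metis (no_types, lifting) scale_eq_0_iff sum.neutral)
    moreover have "e b * ((u b)\<^sup>2 * (b \<bullet> b)) \<le> 0" if "b \<in> B" for b
      using e(1)[OF that] by (simp add: mult_nonpos_nonneg)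
    moreover have "e b * ((u b)\<^sup>2 * (b \<bullet> b)) < 0" if "b \<in> B" "u b \<noteq> 0" for b
    proof -
      have "b \<noteq> 0" using B(2) that by metis
      then show ?thesis using e(1) that by (intro mult_neg_pos mult_pos_pos) auto
    qed
    ultimately show ?thesis unfolding eq
      using sum_strict_mono_ex1[of B "\<lambda>b. e b * ((u b)\<^sup>2 * (b \<bullet> b))" "\<lambda>_. 0"] B(4) by auto
  qed
  have subP: "subspace P" unfolding P_def by (rule subspace_orthogonal_to_vectors)
  have pos: "y \<bullet> (A *v y) \<ge> 0" if "y \<in> P" for y
  proof (rule ccontr)
    assume *: "\<not> ?thesis"
    have inv: "A *v z \<in> P" if "z \<in> P" for z
    proof -
      have "orthogonal b (A *v z)" if "b \<in> B" for b
        using e(2)[OF that] \<open>z \<in> P\<close> that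
        by (simp add: orthogonal_def symmetric_matrix_inner[OF sym] P_def span_base)
      then have "orthogonal (A *v z) x" if "x \<in> span B" for x
        using orthogonal_to_span[OF that] orthogonal_commute by blast
      then show ?thesis by (simp add: P_def orthogonal_commute)
    qed
    from * have "y \<bullet> (A *v y) < 0" by simp
    from negative_form_imp_eigenvector[OF sym subP inv that this]
    obtain c v where "c < 0" "v \<in> P" "v \<noteq> 0" "A *v v = c *\<^sub>R v" .
    moreover from this have "v \<in> span B" using all by blast
    ultimately have "orthogonal v v" unfolding P_def by blast
    then show False using \<open>v \<noteq> 0\<close> by (simp add: orthogonal_self)
  qed
  have "\<forall>x\<in>span B. L x = 0 \<longrightarrow> x = 0"
    using L(3) neg linorder_not_less by blast
  then have "inj_on L (span (span B))"
    unfolding span_span linear_injective_on_subspace_0[OF L(1) subspace_span] .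
  then have "dim (span B) = dim (L ` span B)"
    using dim_image_eq[OF L(1), of "span B"] by simp
  moreover have "L ` span B \<subseteq> S" using L(2) by blast
  ultimately have le: "neg_index A \<le> dim S" using dimN dim_subset by metis
  have injJ: "inj_on J (span S)"
  proof -
    have "x = 0" if "x \<in> S" "J x = 0" for x
      using J(2)[OF that(1)] that(2) by (cases "x = 0") simp_all
    then show ?thesis
      using linear_injective_on_subspace_0[OF J(1) S] S by (metis span_eq_iff)
  qed
  have dimJ: "dim (J ` S) = dim S" using dim_image_eq[OF J(1) injJ] by simp
  have JP: "J ` S \<inter> P = {0}"
  proof -
    have "J y = 0" if "y \<in> S" "J y \<in> P" for y
    proof (cases "y = 0")
      case False
      then show ?thesis using J(2)[OF that(1)] pos[OF that(2)] by simp
    qed (simp add: linear_0[OF J(1)])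
    moreover have "0 \<in> J ` S" using linear_0[OF J(1)] subspace_0[OF S] by (metis imageI)
    ultimately show ?thesis using subspace_0[OF subP] by blast
  qed
  have "dim {x + y |x y. x \<in> J ` S \<and> y \<in> P} + dim (J ` S \<inter> P) = dim (J ` S) + dim P"
    by (rule dim_sums_Int[OF linear_subspace_image[OF J(1) S] subP])
  moreover have "dim {x + y |x y. x \<in> J ` S \<and> y \<in> P} \<le> DIM(real^'n)" by (rule dim_subset_UNIV)
  moreover have "dim P + dim (span B) = DIM(real^'n)"
    using dim_subspace_orthogonal_to_vectors[of "span B" UNIV] unfolding P_def by simp
  moreover have "dim (J ` S \<inter> P) = 0" unfolding JP by simp
  ultimately have "dim S \<le> neg_index A" unfolding dimN dimJ by linarith
  with le show ?thesis by simp
qed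

section \<open>Configurations up to rotation\<close>

lemma act_nth [simp]: "act A X $ i = A *v (X $ i)"
  by (simp add: act_def)

lemma linear_act: "linear (act A)"
  by (simp add: linear_iff vec_eq_iff matrix_vector_right_distrib matrix_vector_mult_scaleR)

lemma act_act: "act A (act B X) = act (A ** B) X"
  by (simp add: vec_eq_iff matrix_vector_mul_assoc)

lemma act_mat_1 [simp]: "act (mat 1) X = X"
  by (simp add: vec_eq_iff)

lemma rotation_matrix_inner:
  fixes Q :: "real^'n^'n"
  assumes "rotation_matrix Q"
  shows "(Q *v x) \<bullet> (Q *v y) = x \<bullet> y"
  using assms orthogonal_transformation_matrix[of "\<lambda>x. Q *v x"]
  by (simp add: rotation_matrix_def orthogonal_transformation_def)

lemma rotation_matrix_norm:
  fixes Q :: "real^'n^'n"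
  assumes "rotation_matrix Q"
  shows "norm (Q *v x) = norm x"
  using rotation_matrix_inner[OF assms] by (simp add: norm_eq_sqrt_inner)

lemma rotation_matrix_mult:
  fixes P Q :: "real^'n^'n"
  assumes "rotation_matrix P" "rotation_matrix Q"
  shows "rotation_matrix (P ** Q)"
  using assms by (simp add: rotation_matrix_def orthogonal_matrix_mul det_mul)

lemma rotation_matrix_transpose:
  fixes Q :: "real^'n^'n"
  assumes "rotation_matrix Q"
  shows "rotation_matrix (transpose Q)" "transpose Q ** Q = mat 1" "Q ** transpose Q = mat 1"
  using assms by (auto simp: rotation_matrix_def orthogonal_matrix_def)

lemma rotation_matrix_mat_1: "rotation_matrix (mat 1)"
  by (simp add: rotation_matrix_def orthogonal_matrix_id)

lemma act_in_sphere_tuples: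
  assumes "rotation_matrix Q" "X \<in> sphere_tuples"
  shows "act Q X \<in> sphere_tuples"
  using assms by (simp add: sphere_tuples_def rotation_matrix_norm)

lemma conf_class_eq:
  assumes "X \<in> sphere_tuples"
  shows "conf_class X = {act Q X | Q. rotation_matrix Q}"
  using assms act_in_sphere_tuples by (auto simp: conf_class_def rotation_rel_def)

lemma conf_class_act:
  assumes "rotation_matrix Q" "X \<in> sphere_tuples"
  shows "conf_class (act Q X) = conf_class X"
proof -
  have "\<exists>P'. act P X = act P' (act Q X) \<and> rotation_matrix P'" if "rotation_matrix P" for P
    using that rotation_matrix_transpose[OF assms(1)]
    by (intro exI[of _ "P ** transpose Q"])
      (simp add: act_act rotation_matrix_mult flip: matrix_mul_assoc)
  then show ?thesis
    unfolding conf_class_eq[OF assms(2)] conf_class_eq[OF act_in_sphere_tuples[OF assms]]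
    using rotation_matrix_mult[OF _ assms(1)] by (auto simp: act_act)
qed

lemma conf_class_eqD:
  assumes "conf_class X = conf_class Y" "X \<in> sphere_tuples" "Y \<in> sphere_tuples"
  obtains Q where "rotation_matrix Q" "Y = act Q X"
proof -
  have "Y \<in> conf_class Y"
    unfolding conf_class_eq[OF assms(3)] using rotation_matrix_mat_1 by (metis (mono_tags, lifting) CollectI act_mat_1)
  then show thesis using that conf_class_eq[OF assms(2)] assms(1) by auto
qed

lemma E_log_act:
  assumes "rotation_matrix Q"
  shows "E_log (act Q X) = E_log X"
  unfolding E_log_def
  by (simp add: rotation_matrix_norm[OF assms] flip: matrix_vector_mult_diff_distrib)

lemma E_log_conf_class:
  assumes "X \<in> sphere_tuples"
  shows "E_log_conf (conf_class X) = E_log X"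
proof -
  have "E_log ` conf_class X = {E_log X}"
    unfolding conf_class_eq[OF assms]
    using E_log_act by (auto simp: image_iff intro!: exI[of _ X] exI[of _ "mat 1"] rotation_matrix_mat_1)
  then show ?thesis by (simp add: E_log_conf_def)
qed

lemma smooth_on_act:
  assumes "open U" "smooth_on U \<phi>"
  shows "smooth_on U (\<lambda>w. act A (\<phi> w))"
  using assms Ck_on_linear[OF _ linear_act] unfolding smooth_on_def by blast

lemma frechet_derivative_act:
  assumes "smooth_on U \<phi>" "u \<in> U"
  shows "frechet_derivative (\<lambda>w. act A (\<phi> w)) (at u) h = act A (frechet_derivative \<phi> (at u) h)"
  using has_derivative_compose[OF smooth_on_has_derivative[OF assms]
      linear_imp_has_derivative[OF linear_act[of A]]]
  by (metis frechet_derivative_at)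

text \<open>Rotating a chart as a whole changes neither the classes it parametrises nor the transversality to the
  orbits: conjugation by a rotation preserves skew-symmetric matrices.\<close>

lemma conf_param_act:
  assumes "conf_param U \<phi>" and Q: "rotation_matrix Q"
  shows "conf_param U (\<lambda>w. act Q (\<phi> w))"
proof -
  have U: "open U" "smooth_on U \<phi>" and sph: "\<And>w. w \<in> U \<Longrightarrow> \<phi> w \<in> sphere_tuples"
    and inj: "inj_on (\<lambda>u. conf_class (\<phi> u)) U"
    and tr: "\<And>u h A. u \<in> U \<Longrightarrow> transpose A = - A \<Longrightarrow>
        frechet_derivative \<phi> (at u) h = act A (\<phi> u) \<Longrightarrow> h = 0 \<and> A = 0"
    using assms(1) unfolding conf_param_def by blast+
  have "h = 0 \<and> A = 0" if u: "u \<in> U" and A: "transpose A = - A"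
    and d: "frechet_derivative (\<lambda>w. act Q (\<phi> w)) (at u) h = act A (act Q (\<phi> u))" for u h A
  proof -
    let ?B = "transpose Q ** A ** Q"
    note QQ = rotation_matrix_transpose[OF Q]
    have "act (transpose Q) (act Q (frechet_derivative \<phi> (at u) h)) = act ?B (\<phi> u)"
      using d by (simp add: frechet_derivative_act[OF U(2) u] act_act matrix_mul_assoc)
    then have "frechet_derivative \<phi> (at u) h = act ?B (\<phi> u)"
      by (simp add: act_act QQ)
    moreover have "transpose ?B = - ?B"
      by (simp add: matrix_transpose_mul A matrix_mul_assoc)
        (simp add: vec_eq_iff matrix_matrix_mult_def sum_negf)
    ultimately have "h = 0" "?B = 0" using tr[OF u] by blast+
    then have "Q ** ?B ** transpose Q = 0" by simp
    moreover have "Q ** ?B ** transpose Q = (Q ** transpose Q) ** A ** (Q ** transpose Q)"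
      by (simp add: matrix_mul_assoc)
    ultimately show ?thesis using \<open>h = 0\<close> by (simp add: QQ)
  qed
  moreover have "inj_on (\<lambda>u. conf_class (act Q (\<phi> u))) U"
    using inj sph conf_class_act[OF Q] by (simp cong: inj_on_cong)
  ultimately show ?thesis
    using U smooth_on_act[OF U] sph act_in_sphere_tuples[OF Q] unfolding conf_param_def by blast
qed

unbundle cross3_syntax

section \<open>Existence of charts\<close>

lemma skew_matrix_inner:
  fixes A :: "real^'n^'n"
  assumes "transpose A = - A"
  shows "x \<bullet> (A *v y) = - ((A *v x) \<bullet> y)"
proof -
  have "x \<bullet> (A *v y) = (transpose A *v x) \<bullet> y"
    by (metis dot_lmul_matrix vector_transpose_matrix transpose_transpose)
  also have "transpose A *v x = - (A *v x)"
    unfolding assms by (simp add: vec_eq_iff matrix_vector_mult_def sum_negf)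
  finally show ?thesis by simp
qed

lemma orthogonal_frame_eq_0:
  fixes x y v :: "real^3"
  assumes "x \<times> y \<noteq> 0" "v \<bullet> x = 0" "v \<bullet> y = 0" "v \<bullet> (x \<times> y) = 0"
  shows "v = 0"
proof -
  have "v \<times> (x \<times> y) = 0"
    using assms(2,3) by (simp add: Lagrange)
  moreover have "(norm (v \<times> (x \<times> y)))\<^sup>2 + (v \<bullet> (x \<times> y))\<^sup>2 = (norm v * norm (x \<times> y))\<^sup>2"
    by (rule norm_cross_dot)
  ultimately show ?thesis using assms by simp
qed

lemma cross3_eq_0_imp_scale:
  fixes z c :: "real^3"
  assumes "z \<times> c = 0" "c \<noteq> 0"
  shows "z = (z \<bullet> c / (c \<bullet> c)) *\<^sub>R c"
proof -
  let ?d = "z - (z \<bullet> c / (c \<bullet> c)) *\<^sub>R c"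
  have "?d \<times> c = 0" "?d \<bullet> c = 0"
    using assms by (simp_all add: Cross3.left_diff_distrib cross_mult_left inner_diff_left)
  then have "?d = 0" using norm_cross_dot[of ?d c] assms(2) by auto
  then show ?thesis by simp
qed

text \<open>The rotation also fixes the cross product, and three independent vectors determine it.\<close>

lemma rotation_fix_two_imp_id:
  assumes Q: "rotation_matrix Q" and "x \<times> y \<noteq> 0" "Q *v x = x" "Q *v y = (y::real^3)"
  shows "Q *v v = v"
proof -
  have "Q *v (x \<times> y) = x \<times> y" using cross_rotation_matrix[OF Q, of x y] assms by simp
  then have "(Q *v v - v) \<bullet> w = 0" if "w \<in> {x, y, x \<times> y}" for w
    using rotation_matrix_inner[OF Q, of v w] assms(3,4) that by (auto simp: inner_diff_left)
  then show ?thesis using orthogonal_frame_eq_0[OF assms(2), of "Q *v v - v"] by simp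
qed

text \<open>The infinitesimal counterpart of the preceding lemma.\<close>

lemma skew_kill_two_imp_0:
  fixes A :: "real^3^3"
  assumes A: "transpose A = - A" and xy: "x \<times> y \<noteq> 0" and "A *v x = 0" "A *v y = 0"
  shows "A = 0"
proof -
  have *: "w \<bullet> (A *v v) = 0" if "w \<in> {x, y}" for v w
    using skew_matrix_inner[OF A, of w v] assms(3,4) that by auto
  have "A *v (x \<times> y) = 0"
  proof (rule orthogonal_frame_eq_0[OF xy])
    show "(A *v (x \<times> y)) \<bullet> (x \<times> y) = 0"
      using skew_matrix_inner[OF A, of "x \<times> y" "x \<times> y"] by (simp add: inner_commute)
  qed (use * in \<open>simp_all add: inner_commute\<close>)
  then have "(x \<times> y) \<bullet> (A *v v) = 0" for v using skew_matrix_inner[OF A, of "x \<times> y" v] by simp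
  then have "A *v v = 0" for v
    using orthogonal_frame_eq_0[OF xy, of "A *v v"] * by (simp add: inner_commute)
  then show ?thesis by (simp add: matrix_eq)
qed

text \<open>Every vector of \<open>B\<close> lowers the dimension by at most one, since \<open>span B\<close> has dimension at most \<open>card B\<close>.\<close>

lemma dim_orthogonal_finite:
  fixes B :: "'a::euclidean_space set"
  assumes "finite B"
  shows "DIM('a) \<le> dim {v. \<forall>w\<in>B. w \<bullet> v = 0} + card B"
proof -
  have "{v. \<forall>w\<in>B. w \<bullet> v = 0} = {v. \<forall>w\<in>span B. orthogonal w v}"
  proof -
    have "orthogonal w v" if "\<forall>w\<in>B. w \<bullet> v = 0" "w \<in> span B" for v w
      using orthogonal_to_span[OF that(2), of v] that(1) by (auto simp: orthogonal_def inner_commute)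
    then show ?thesis by (auto simp: orthogonal_def span_base)
  qed
  then have "dim {v. \<forall>w\<in>B. w \<bullet> v = 0} + dim (span B) = DIM('a)"
    using dim_subspace_orthogonal_to_vectors[of "span B" UNIV] by simp
  moreover have "dim (span B) \<le> card B" using dim_le_card'[OF assms] by simp
  ultimately show ?thesis by linarith
qed

definition unit_vec :: "'a::real_normed_vector \<Rightarrow> 'a" where
  "unit_vec x = inverse (norm x) *\<^sub>R x"

lemma smooth_on_vec_lambda_unit_vec:
  fixes f :: "'n::finite \<Rightarrow> 'a::euclidean_space \<Rightarrow> 'b::euclidean_space"
  assumes "open S" "\<And>i. smooth_on S (f i)" "\<And>i x. x \<in> S \<Longrightarrow> f i x \<noteq> 0"
  shows "smooth_on S (\<lambda>x. \<chi> i. unit_vec (f i x))"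
proof -
  have "Ck_on k S (\<lambda>x. \<Sum>i\<in>UNIV. axis i (inverse (sqrt (f i x \<bullet> f i x)) *\<^sub>R f i x))" for k
  proof (intro Ck_on_sum assms(1))
    fix i :: 'n
    show "Ck_on k S (\<lambda>x. axis i (inverse (sqrt (f i x \<bullet> f i x)) *\<^sub>R f i x))"
    proof (rule Ck_on_linear[OF assms(1), of "axis i"])
      show "linear (axis i :: 'b \<Rightarrow> 'b^'n)" by (simp add: linear_iff axis_def vec_eq_iff)
      show "Ck_on k S (\<lambda>x. inverse (sqrt (f i x \<bullet> f i x)) *\<^sub>R f i x)"
        using assms(2,3) unfolding smooth_on_def
        by (intro Ck_on_bilinear[OF assms(1) bounded_bilinear_scaleR]
            Ck_on_inverse_sqrt Ck_on_bilinear[OF assms(1) bounded_bilinear_inner] assms(1)) auto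
    qed
  qed
  moreover have "(\<chi> i. unit_vec (f i x)) = (\<Sum>i\<in>UNIV. axis i (inverse (sqrt (f i x \<bullet> f i x)) *\<^sub>R f i x))" for x
    by (simp add: vec_eq_iff axis_def unit_vec_def norm_eq_sqrt_inner if_distrib cong: if_cong)
  ultimately show ?thesis by (simp add: smooth_on_def)
qed

text \<open>The chart keeps the point \<open>p\<close> at \<open>X $ p\<close>, moves the point \<open>q\<close> in the half-plane that \<open>X $ q\<close> spans with the axis
  through \<open>X $ p\<close>, and moves the other points freely, by central projection from the tangent planes at
  the \<open>X $ i\<close>.  At most \<open>5 + 3 = 8\<close> linear conditions are imposed on the \<open>15\<close> coordinates of the displacement,
  which leaves the required \<open>7\<close> dimensions.  A rotation that maps one such tuple to another fixes \<open>X $ p\<close> and the normal \<open>c\<close>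
  of the half-plane, hence is the identity.\<close>

lemma exists_chart:
  fixes X :: "real^3^5"
  assumes X: "X \<in> sphere_tuples" and c0: "X $ p \<times> X $ q \<noteq> 0"
  obtains U \<phi> u where "conf_param U \<phi>" "u \<in> U" "\<phi> u = X"
proof -
  define c where "c = X $ p \<times> X $ q"
  have c: "c \<noteq> 0" using c0 c_def by simp
  have pq: "p \<noteq> q" using c0 by auto
  have nX: "norm (X $ i) = 1" for i using X by (simp add: sphere_tuples_def)
  have XX: "X $ i \<bullet> X $ i = 1" for i using nX[of i] by (simp add: norm_eq_1)
  define B where "B = range (\<lambda>i. axis i (X $ i)) \<union> {axis p c, axis p (X $ p \<times> c), axis q c}"
  define V where "V = {v. \<forall>w\<in>B. w \<bullet> v = 0}"
  have axis_dot: "axis i a \<bullet> v = a \<bullet> v $ i" for i :: 5 and a :: "real^3" and v :: "real^3^5"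
    by (metis inner_axis inner_commute)
  have Vt: "X $ i \<bullet> v $ i = 0" if "v \<in> V" for v i using that by (auto simp: V_def B_def axis_dot)
  have Vq: "c \<bullet> v $ q = 0" if "v \<in> V" for v using that by (auto simp: V_def B_def axis_dot)
  have Vp: "v $ p = 0" if "v \<in> V" for v
  proof -
    have "c \<bullet> v $ p = 0" "(X $ p \<times> c) \<bullet> v $ p = 0" "X $ p \<bullet> v $ p = 0"
      using that by (auto simp: V_def B_def axis_dot)
    moreover have "X $ p \<times> c \<noteq> 0"
      using norm_cross_dot[of "X $ p" c] c nX by (auto simp: c_def dot_cross_self)
    ultimately show ?thesis
      using orthogonal_frame_eq_0[of "X $ p" c "v $ p"] by (simp add: inner_commute)
  qed
  have subV: "subspace V"
    by (auto simp: V_def subspace_def inner_simps)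
  have "card B \<le> 8"
  proof -
    have "card (range (\<lambda>i::5. axis i (X $ i))) \<le> 5" using card_image_le[of UNIV "\<lambda>i::5. axis i (X $ i)"] by simp
    moreover have "card {axis p c, axis p (X $ p \<times> c), axis q c} \<le> 3"
      by (simp add: card_insert_if)
    ultimately show ?thesis unfolding B_def
      using card_Un_le[of "range (\<lambda>i. axis i (X $ i))" "{axis p c, axis p (X $ p \<times> c), axis q c}"] by linarith
  qed
  moreover have "finite B" by (simp add: B_def)
  ultimately have "dim V \<ge> 7"
    using dim_orthogonal_finite[of B] by (simp add: V_def)
  then obtain L :: "real^7 \<Rightarrow> real^3^5" where L: "linear L" "L \<in> UNIV \<rightarrow> V" "\<And>x. norm (L x) = norm x"
    using isometry_subset_subspace[of "UNIV :: (real^7) set" V] subV by auto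
  have LV: "L u \<in> V" for u using L(2) by blast
  define f where "f i u = X $ i + L u $ i" for i u
  define \<phi> where "\<phi> u = (\<chi> i. unit_vec (f i u))" for u
  define U where "U = {u. (X $ p \<times> f q u) \<bullet> c > 0}"
  have Xf: "X $ i \<bullet> f i u = 1" for i u using Vt[OF LV] XX by (simp add: f_def inner_add_right)
  then have f0: "f i u \<noteq> 0" for i u by (metis inner_zero_right zero_neq_one)
  have lin: "linear (\<lambda>u. L u $ i)" for i
    using L(1) by (simp add: linear_iff)
  have smf: "smooth_on U' (f i)" if "open U'" for U' i
    unfolding f_def smooth_on_def using that
    by (auto intro!: Ck_on_add Ck_on_const Ck_on_linear[OF _ lin] Ck_on_ident)
  have contf: "continuous_on UNIV (f i)" for i
    using smf[OF open_UNIV, of i] Ck_on.simps(1) unfolding smooth_on_def by blast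
  have opU: "open U"
  proof -
    have "continuous_on UNIV (\<lambda>u. (X $ p \<times> f q u) \<bullet> c)"
      by (intro continuous_intros continuous_on_cross contf)
    then show ?thesis unfolding U_def by (intro open_Collect_less) auto
  qed
  have sm\<phi>: "smooth_on UNIV \<phi>" "smooth_on U \<phi>"
    unfolding \<phi>_def using opU f0 by (auto intro!: smooth_on_vec_lambda_unit_vec smf)
  have phi_nth: "\<phi> u $ i = inverse (norm (f i u)) *\<^sub>R f i u" for u i
    by (simp add: \<phi>_def unit_vec_def)
  have n\<phi>: "norm (\<phi> u $ i) = 1" for u i using f0 by (simp add: phi_nth)
  have \<phi>X: "\<phi> u $ i \<bullet> X $ i = inverse (norm (f i u))" for u i
    using Xf[of i u] by (simp add: phi_nth inner_commute)
  have f\<phi>: "(\<phi> u $ i \<bullet> X $ i) *\<^sub>R f i u = \<phi> u $ i" for u i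
    by (metis \<phi>X phi_nth)
  have \<phi>p: "\<phi> u $ p = X $ p" for u
    using Vp[OF LV] by (simp add: phi_nth f_def nX)
  have \<phi>q: "\<phi> u $ q \<bullet> c = 0" for u
  proof -
    have "X $ q \<bullet> c = 0" by (simp add: c_def dot_cross_self)
    moreover have "L u $ q \<bullet> c = 0" using Vq[OF LV] by (metis inner_commute)
    ultimately show ?thesis by (simp add: phi_nth f_def inner_add_left)
  qed
  \<comment> \<open>the plane spanned by the two anchored points is fixed and so is its orientation\<close>
  have normal: "\<exists>a>0. X $ p \<times> \<phi> u $ q = a *\<^sub>R c" if "u \<in> U" for u
  proof -
    have "(X $ p \<times> \<phi> u $ q) \<times> c = 0"
    proof -
      have "(x \<times> y) \<times> c = (x \<bullet> c) *\<^sub>R y - (y \<bullet> c) *\<^sub>R x" for x y :: "real^3"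
        by (simp add: cross3_simps forall_3)
      then show ?thesis using \<phi>q by (simp add: c_def dot_cross_self)
    qed
    then have "X $ p \<times> \<phi> u $ q = ((X $ p \<times> \<phi> u $ q) \<bullet> c / (c \<bullet> c)) *\<^sub>R c"
      by (rule cross3_eq_0_imp_scale[OF _ c])
    moreover have "(X $ p \<times> \<phi> u $ q) \<bullet> c > 0"
      using that f0[of q u] by (simp add: U_def phi_nth cross_mult_right)
    ultimately show ?thesis using c by (metis divide_pos_pos inner_gt_zero_iff)
  qed
  have inj: "inj_on (\<lambda>u. conf_class (\<phi> u)) U"
  proof (rule inj_onI)
    fix u v assume uv: "u \<in> U" "v \<in> U" "conf_class (\<phi> u) = conf_class (\<phi> v)"
    obtain Q where Q: "rotation_matrix Q" "\<phi> v = act Q (\<phi> u)"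
      using conf_class_eqD[OF uv(3)] n\<phi> by (auto simp: sphere_tuples_def)
    obtain a b where ab: "a > 0" "X $ p \<times> \<phi> u $ q = a *\<^sub>R c" "b > 0" "X $ p \<times> \<phi> v $ q = b *\<^sub>R c"
      using normal uv by metis
    have Qp: "Q *v X $ p = X $ p" using Q(2) \<phi>p by (metis act_nth)
    have "Q *v (a *\<^sub>R c) = b *\<^sub>R c"
      using cross_rotation_matrix[OF Q(1), of "X $ p" "\<phi> u $ q"] Q(2) Qp ab by simp
    moreover from this have "a * norm c = b * norm c"
      using rotation_matrix_norm[OF Q(1), of "a *\<^sub>R c"] ab by auto
    ultimately have Qc: "Q *v c = c" using ab c by (simp add: matrix_vector_mult_scaleR)
    have "X $ p \<times> c \<noteq> 0"
      using norm_cross_dot[of "X $ p" c] c nX by (auto simp: c_def dot_cross_self)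
    then have "Q *v w = w" for w using rotation_fix_two_imp_id[OF Q(1) _ Qp Qc] by blast
    then have eq: "\<phi> v = \<phi> u" using Q(2) by (simp add: vec_eq_iff)
    have "f i u = f i v" for i
    proof -
      have "(\<phi> u $ i \<bullet> X $ i) *\<^sub>R f i u = (\<phi> u $ i \<bullet> X $ i) *\<^sub>R f i v"
        using f\<phi>[of u i] f\<phi>[of v i] unfolding eq by simp
      moreover have "\<phi> u $ i \<bullet> X $ i \<noteq> 0" using \<phi>X[of u i] f0[of i u] by simp
      ultimately show ?thesis by simp
    qed
    then have "L u = L v" by (simp add: f_def vec_eq_iff)
    then have "norm (L (u - v)) = 0" by (simp add: linear_diff[OF L(1)])
    then show "u = v" by (simp add: L(3))
  qed
  have tr: "h = 0 \<and> A = 0" if u: "u \<in> U" and A: "transpose A = - A"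
    and d: "frechet_derivative \<phi> (at u) h = act A (\<phi> u)" for u h A
  proof -
    let ?D = "frechet_derivative \<phi> (at u)"
    have der: "(\<phi> has_derivative ?D) (at u)"
      by (rule smooth_on_has_derivative[OF sm\<phi>(1)]) simp
    have der_i: "((\<lambda>w. \<phi> w $ i) has_derivative (\<lambda>h. ?D h $ i)) (at u)" for i
      by (rule bounded_linear.has_derivative[OF bounded_linear_vec_nth der])
    have "((\<lambda>w. \<phi> w $ p) has_derivative (\<lambda>h. 0)) (at u)" by (simp add: \<phi>p)
    then have "?D h $ p = 0" using has_derivative_unique[OF der_i] by metis
    then have Ap: "A *v X $ p = 0" using d \<phi>p by simp
    let ?y = "\<phi> u $ q"
    have "((\<lambda>w. \<phi> w $ q \<bullet> c) has_derivative (\<lambda>h. ?D h $ q \<bullet> c)) (at u)"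
      by (rule has_derivative_inner_left[OF der_i])
    moreover have "((\<lambda>w. \<phi> w $ q \<bullet> c) has_derivative (\<lambda>h. 0)) (at u)" by (simp add: \<phi>q)
    ultimately have "?D h $ q \<bullet> c = 0" using has_derivative_unique by metis
    then have yc: "(A *v ?y) \<bullet> c = 0" using d by simp
    obtain a where a: "a > 0" "X $ p \<times> ?y = a *\<^sub>R c" using normal[OF u] by blast
    have Aq: "A *v ?y = 0"
    proof (rule orthogonal_frame_eq_0[of "X $ p" ?y])
      show "X $ p \<times> ?y \<noteq> 0" using a c by simp
      show "(A *v ?y) \<bullet> X $ p = 0" using skew_matrix_inner[OF A, of "X $ p" ?y] Ap by (simp add: inner_commute)
      show "(A *v ?y) \<bullet> ?y = 0" using skew_matrix_inner[OF A, of ?y ?y] by (simp add: inner_commute)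
      show "(A *v ?y) \<bullet> (X $ p \<times> ?y) = 0" using yc a by simp
    qed
    have A0: "A = 0" using skew_kill_two_imp_0[OF A _ Ap Aq] a c by simp
    have "act 0 (\<phi> u) = 0" by (simp add: vec_eq_iff[of "act 0 (\<phi> u)"])
    then have D0: "?D h = 0" using d A0 by simp
    have "L h $ i = 0" for i
    proof -
      have "(f i has_derivative (\<lambda>h. L h $ i)) (at u)"
        unfolding f_def using linear_imp_has_derivative[OF lin[of i]]
        by (auto intro!: derivative_eq_intros)
      then have "((\<lambda>w. (\<phi> w $ i \<bullet> X $ i) *\<^sub>R f i w) has_derivative
          (\<lambda>h. (\<phi> u $ i \<bullet> X $ i) *\<^sub>R L h $ i + (?D h $ i \<bullet> X $ i) *\<^sub>R f i u)) (at u)"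
        by (intro has_derivative_scaleR has_derivative_inner_left der_i)
      then have "(\<phi> u $ i \<bullet> X $ i) *\<^sub>R L h $ i + (?D h $ i \<bullet> X $ i) *\<^sub>R f i u = ?D h $ i"
        unfolding f\<phi> by (rule fun_cong[OF has_derivative_unique[OF _ der_i]])
      then show ?thesis using \<phi>X[of u i] f0[of i u] by (simp add: D0)
    qed
    then have "L h = 0" by (simp add: vec_eq_iff)
    then have "h = 0" using L(3)[of h] by simp
    then show ?thesis using A0 by simp
  qed
  have f_0: "f i 0 = X $ i" for i by (simp add: f_def linear_0[OF L(1)])
  have "\<phi> 0 = X" unfolding vec_eq_iff[of "\<phi> 0"] by (simp add: phi_nth f_0 nX)
  moreover have "0 \<in> U" using c by (simp add: U_def f_0 flip: c_def)
  moreover have "conf_param U \<phi>"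
    unfolding conf_param_def using opU sm\<phi> inj tr n\<phi> by (auto simp: sphere_tuples_def)
  ultimately show thesis using that by blast
qed

section \<open>First and second variation of the logarithmic energy\<close>

text \<open>The vanishing of the tangential gradient of the energy.  Diagonal terms are \<open>0\<close>, because \<open>inverse 0 = 0\<close>.\<close>

definition stationary :: "real^3^5 \<Rightarrow> bool" where
  "stationary X \<longleftrightarrow>
     (\<forall>i. (\<Sum>j\<in>UNIV. (X $ i - X $ j) /\<^sub>R ((X $ i - X $ j) \<bullet> (X $ i - X $ j))) = 2 *\<^sub>R X $ i)"

definition tangent :: "real^3^5 \<Rightarrow> (real^3^5) set" where
  "tangent X = {v. \<forall>i. v $ i \<bullet> X $ i = 0}"

text \<open>The second derivative of the energy at a stationary tuple along tangent vectors, as a bilinear form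
  on the whole ambient space.\<close>

definition hess_form :: "real^3^5 \<Rightarrow> real^3^5 \<Rightarrow> real^3^5 \<Rightarrow> real" where
  "hess_form X v w = 4 * (\<Sum>i\<in>UNIV. v $ i \<bullet> w $ i)
     - (\<Sum>i\<in>UNIV. \<Sum>j\<in>UNIV.
          (v $ i - v $ j) \<bullet> (w $ i - w $ j) / ((X $ i - X $ j) \<bullet> (X $ i - X $ j)))
     + 2 * (\<Sum>i\<in>UNIV. \<Sum>j\<in>UNIV.
          ((X $ i - X $ j) \<bullet> (v $ i - v $ j)) * ((X $ i - X $ j) \<bullet> (w $ i - w $ j))
            / ((X $ i - X $ j) \<bullet> (X $ i - X $ j))\<^sup>2)"

text \<open>With \<open>ln 0 = 0\<close> the diagonal terms vanish, so that the sum may run over all pairs.\<close>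

lemma E_log_eq:
  "E_log X = - (\<Sum>i\<in>UNIV. \<Sum>j\<in>UNIV. ln ((X $ i - X $ j) \<bullet> (X $ i - X $ j))) / 2"
proof -
  have *: "ln (1 / norm z) = - ln (z \<bullet> z) / 2" for z :: "real^3"
    by (cases "z = 0") (simp_all add: norm_eq_sqrt_inner ln_div ln_sqrt)
  have "(\<Sum>j\<in>UNIV - {i}. ln (1 / norm (X $ i - X $ j))) = (\<Sum>j\<in>UNIV. ln (1 / norm (X $ i - X $ j)))" for i
    by (subst (2) sum.remove[of _ i]) auto
  then show ?thesis
    unfolding E_log_def * by (simp add: sum_negf sum_divide_distrib)
qed

text \<open>The summand is antisymmetric in \<open>i\<close> and \<open>j\<close> before pairing, so both halves of \<open>p $ i - p $ j\<close> contribute the same.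
  This identity disposes of every term that is linear in a displacement: the first derivative, the
  acceleration of the chart, and the pairing with rotations.\<close>

lemma stationary_pairing:
  assumes "stationary X"
  shows "(\<Sum>i\<in>UNIV. \<Sum>j\<in>UNIV. (X $ i - X $ j) \<bullet> (p $ i - p $ j) / ((X $ i - X $ j) \<bullet> (X $ i - X $ j)))
    = 4 * (\<Sum>i\<in>UNIV. X $ i \<bullet> p $ i)"
proof -
  define g where "g i j = (X $ i - X $ j) /\<^sub>R ((X $ i - X $ j) \<bullet> (X $ i - X $ j))" for i j
  have sw: "g j i = - g i j" for i j
    unfolding g_def by (simp add: inner_simps inner_commute flip: scaleR_minus_right)
  have gs: "(\<Sum>j\<in>UNIV. g i j) = 2 *\<^sub>R X $ i" for i
    using assms by (simp add: stationary_def g_def)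
  have "(\<Sum>i\<in>UNIV. \<Sum>j\<in>UNIV. g i j \<bullet> p $ i) = 2 * (\<Sum>i\<in>UNIV. X $ i \<bullet> p $ i)"
    by (simp add: gs sum_distrib_left flip: inner_sum_left)
  moreover have "(\<Sum>i\<in>UNIV. \<Sum>j\<in>UNIV. g i j \<bullet> p $ j) = - (\<Sum>i\<in>UNIV. \<Sum>j\<in>UNIV. g i j \<bullet> p $ i)"
  proof -
    have "(\<Sum>i\<in>UNIV. \<Sum>j\<in>UNIV. g i j \<bullet> p $ j) = (\<Sum>i\<in>UNIV. \<Sum>j\<in>UNIV. g j i \<bullet> p $ i)"
      by (rule sum.swap)
    also have "\<dots> = (\<Sum>i\<in>UNIV. \<Sum>j\<in>UNIV. - (g i j \<bullet> p $ i))"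
      by (intro sum.cong refl) (metis sw inner_minus_left)
    finally show ?thesis by (simp add: sum_negf)
  qed
  ultimately have "(\<Sum>i\<in>UNIV. \<Sum>j\<in>UNIV. g i j \<bullet> (p $ i - p $ j)) = 4 * (\<Sum>i\<in>UNIV. X $ i \<bullet> p $ i)"
    by (simp add: inner_diff_right sum_subtractf)
  then show ?thesis by (simp add: g_def divide_inverse mult.commute)
qed

lemma bilinear_hess_form: "bilinear (hess_form X)"
proof -
  have "linear (hess_form X v)" for v
    unfolding hess_form_def
    by (rule linearI)
      (simp_all add: inner_simps sum.distrib add_divide_distrib diff_divide_distrib algebra_simps
         sum_subtractf sum_distrib_left)
  moreover have "hess_form X v w = hess_form X w v" for v w
    unfolding hess_form_def by (simp add: inner_commute mult.commute)
  ultimately show ?thesis by (simp add: bilinear_def)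
qed

lemma hess_form_commute: "hess_form X v w = hess_form X w v"
  unfolding hess_form_def by (simp add: inner_commute mult.commute)

text \<open>A rotation keeps all distances to first order, which kills the last sum of the form, and the first
  two cancel by stationarity.\<close>

lemma hess_form_rotation:
  assumes X: "stationary X" and A: "transpose A = - A"
  shows "hess_form X v (act A X) = 0"
proof -
  have 1: "(X $ i - X $ j) \<bullet> (act A X $ i - act A X $ j) = 0" for i j
    using skew_matrix_inner[OF A, of "X $ i - X $ j" "X $ i - X $ j"]
    by (simp add: matrix_vector_mult_diff_distrib inner_commute)
  have 2: "(v $ i - v $ j) \<bullet> (act A X $ i - act A X $ j)
      = - ((X $ i - X $ j) \<bullet> (act A v $ i - act A v $ j))" for i j
    using skew_matrix_inner[OF A, of "v $ i - v $ j" "X $ i - X $ j"]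
    by (simp add: matrix_vector_mult_diff_distrib inner_commute)
  have 3: "v $ i \<bullet> act A X $ i = - (X $ i \<bullet> act A v $ i)" for i
    using skew_matrix_inner[OF A, of "v $ i" "X $ i"] by (simp add: inner_commute)
  show ?thesis
    unfolding hess_form_def 1 2 3 minus_divide_left[symmetric] sum_negf stationary_pairing[OF X]
    by simp
qed

lemma has_derivative_ln_inner_self:
  assumes "(z has_derivative Z) (at x)" "z x \<noteq> (0 :: 'b::real_inner)"
  shows "((\<lambda>w. ln (z w \<bullet> z w)) has_derivative (\<lambda>h. 2 * (z x \<bullet> Z h) / (z x \<bullet> z x))) (at x)"
  using assms
  by (auto intro!: derivative_eq_intros simp: inner_commute field_simps)

lemma has_derivative_inner_quotient:
  assumes "(z has_derivative z') (at x)" "(Z has_derivative Z') (at x)" "z x \<noteq> (0 :: 'b::real_inner)"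
  shows "((\<lambda>w. z w \<bullet> Z w / (z w \<bullet> z w)) has_derivative
     (\<lambda>h. (z' h \<bullet> Z x + z x \<bullet> Z' h) / (z x \<bullet> z x)
          - 2 * ((z x \<bullet> z' h) * (z x \<bullet> Z x)) / (z x \<bullet> z x)\<^sup>2)) (at x)"
proof -
  have "((\<lambda>w. z w \<bullet> Z w / (z w \<bullet> z w)) has_derivative
     (\<lambda>h. ((z x \<bullet> Z' h + z' h \<bullet> Z x) * (z x \<bullet> z x) - (z x \<bullet> Z x) * (z x \<bullet> z' h + z' h \<bullet> z x))
          / ((z x \<bullet> z x) * (z x \<bullet> z x)))) (at x)"
    using assms by (intro has_derivative_divide' has_derivative_inner) auto
  moreover have "((z x \<bullet> Z' h + z' h \<bullet> Z x) * (z x \<bullet> z x) - (z x \<bullet> Z x) * (z x \<bullet> z' h + z' h \<bullet> z x))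
          / ((z x \<bullet> z x) * (z x \<bullet> z x)) =
     (z' h \<bullet> Z x + z x \<bullet> Z' h) / (z x \<bullet> z x)
          - 2 * ((z x \<bullet> z' h) * (z x \<bullet> Z x)) / (z x \<bullet> z x)\<^sup>2" for h
    using assms(3) by (simp add: field_simps power2_eq_square inner_commute)
  ultimately show ?thesis by simp
qed

text \<open>The terms with the second derivative of \<open>\<phi>\<close> add up to a multiple of \<open>\<Sum> \<phi>\<^sub>i \<bullet> \<partial>\<^sup>2\<phi>\<^sub>i\<close> by stationarity.  Differentiating
  \<open>|\<phi>\<^sub>i|\<^sup>2 = 1\<close> twice turns this into minus the inner product of the first derivatives, which is the
  source of the first sum in \<open>hess_form\<close>.\<close>

lemma energy_second_variation:
  fixes \<phi> :: "real^'n \<Rightarrow> real^3^5"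
  assumes U: "open U" "u \<in> U" and sm: "smooth_on U \<phi>"
    and sph: "\<And>w. w \<in> U \<Longrightarrow> \<phi> w \<in> sphere_tuples"
    and dist: "inj (\<lambda>i. \<phi> u $ i)" and stat: "stationary (\<phi> u)"
    and g: "\<And>w. w \<in> U \<Longrightarrow> g w = E_log (\<phi> w)"
  shows "\<exists>W. open W \<and> u \<in> W \<and> smooth_on W g"
    and "(g has_derivative (\<lambda>_. 0)) (at u)"
    and "frechet_derivative \<phi> (at u) h \<in> tangent (\<phi> u)"
    and "hessian g u $ i $ j =
       hess_form (\<phi> u) (frechet_derivative \<phi> (at u) (axis i 1)) (frechet_derivative \<phi> (at u) (axis j 1))"
proof -
  let ?D = "\<lambda>w. frechet_derivative \<phi> (at w)"
  let ?z = "\<lambda>i j w. \<phi> w $ i - \<phi> w $ j"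
  define W where "W = {w \<in> U. \<forall>i j. i \<noteq> j \<longrightarrow> \<phi> w $ i \<noteq> \<phi> w $ j}"
  have WU: "W \<subseteq> U" and uW: "u \<in> W" using U(2) dist by (auto simp: W_def inj_def)
  have z0: "?z i j w \<noteq> 0" if "w \<in> W" "i \<noteq> j" for i j w using that by (auto simp: W_def)
  have cont: "continuous_on U \<phi>" using sm Ck_on.simps(1) unfolding smooth_on_def by blast
  have opW: "open W"
  proof -
    have "open {w \<in> U. ?z i j w \<noteq> 0}" for i j
    proof -
      have "continuous_on U (?z i j)" by (intro continuous_intros cont)
      then have "open (U \<inter> ?z i j -` (- {0}))" using U(1) by (intro continuous_open_preimage) auto
      moreover have "U \<inter> ?z i j -` (- {0}) = {w \<in> U. ?z i j w \<noteq> 0}" by auto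
      ultimately show ?thesis by simp
    qed
    then have "open (U \<inter> (\<Inter>(i, j)\<in>{(i, j). i \<noteq> j}. {w \<in> U. ?z i j w \<noteq> 0}))"
      using U(1) by (intro open_Int open_INT) auto
    moreover have "U \<inter> (\<Inter>(i, j)\<in>{(i, j). i \<noteq> j}. {w \<in> U. ?z i j w \<noteq> 0}) = W"
      unfolding W_def by auto
    ultimately show ?thesis by simp
  qed
  have smW: "smooth_on W \<phi>" using sm WU Ck_on_subset unfolding smooth_on_def by blast
  have "Ck_on k W g" for k
  proof (rule Ck_on_cong[OF opW])
    have "Ck_on k W (\<lambda>w. ln (?z i j w \<bullet> ?z i j w))" for i j
    proof (cases "i = j")
      case False
      have lin: "linear (\<lambda>x::real^3^5. x $ i - x $ j)" by (simp add: linear_iff algebra_simps)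
      have "Ck_on k W (?z i j)"
        using smW Ck_on_linear[OF opW lin] unfolding smooth_on_def by blast
      then show ?thesis
        using z0 False
        by (intro Ck_on_ln[OF opW] Ck_on_bilinear[OF opW bounded_bilinear_inner]) auto
    qed (simp add: Ck_on_const opW)
    then have "Ck_on k W (\<lambda>w. - 1 / 2 * (\<Sum>i\<in>UNIV. \<Sum>j\<in>UNIV. ln (?z i j w \<bullet> ?z i j w)))"
      by (intro Ck_on_linear[OF opW, of "\<lambda>x. - 1 / 2 * x"] Ck_on_sum opW) (auto simp: linear_iff field_simps)
    then show "Ck_on k W (\<lambda>w. - 1 / 2 * (\<Sum>i\<in>UNIV. \<Sum>j\<in>UNIV. ln (?z i j w \<bullet> ?z i j w)))" .
    show "- 1 / 2 * (\<Sum>i\<in>UNIV. \<Sum>j\<in>UNIV. ln (?z i j w \<bullet> ?z i j w)) = g w" if "w \<in> W" for w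
      using that g WU by (auto simp: E_log_eq)
  qed
  then show "\<exists>W. open W \<and> u \<in> W \<and> smooth_on W g"
    using opW uW unfolding smooth_on_def by blast
  have der: "(\<phi> has_derivative ?D w) (at w)" if "w \<in> U" for w
    using smooth_on_has_derivative[OF sm that] .
  have der_i: "((\<lambda>w. \<phi> w $ i) has_derivative (\<lambda>h. ?D w h $ i)) (at w)" if "w \<in> U" for w i
    by (rule bounded_linear.has_derivative[OF bounded_linear_vec_nth der[OF that]])
  have der_z: "(?z i j has_derivative (\<lambda>h. ?D w h $ i - ?D w h $ j)) (at w)" if "w \<in> U" for w i j
    by (intro has_derivative_diff der_i that)
  define G where "G w h = - (\<Sum>i\<in>UNIV. \<Sum>j\<in>UNIV. ?z i j w \<bullet> (?D w h $ i - ?D w h $ j) / (?z i j w \<bullet> ?z i j w))"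
    for w h
  have gD: "(g has_derivative G w) (at w)" if w: "w \<in> W" for w
  proof -
    have "((\<lambda>w. ln (?z i j w \<bullet> ?z i j w)) has_derivative
        (\<lambda>h. 2 * (?z i j w \<bullet> (?D w h $ i - ?D w h $ j)) / (?z i j w \<bullet> ?z i j w))) (at w)" for i j
      using z0[OF w, of i j] w WU by (cases "i = j") (auto intro!: has_derivative_ln_inner_self der_z)
    then have "((\<lambda>w. - (\<Sum>i\<in>UNIV. \<Sum>j\<in>UNIV. ln (?z i j w \<bullet> ?z i j w)) / 2) has_derivative
        (\<lambda>h. - (\<Sum>i\<in>UNIV. \<Sum>j\<in>UNIV. 2 * (?z i j w \<bullet> (?D w h $ i - ?D w h $ j)) / (?z i j w \<bullet> ?z i j w)) / 2)) (at w)"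
      by (intro bounded_linear.has_derivative[OF bounded_linear_divide] has_derivative_minus has_derivative_sum)
    moreover have "(\<lambda>h. - (\<Sum>i\<in>UNIV. \<Sum>j\<in>UNIV. 2 * (?z i j w \<bullet> (?D w h $ i - ?D w h $ j)) / (?z i j w \<bullet> ?z i j w)) / 2) = G w"
      unfolding G_def by (simp add: fun_eq_iff flip: sum_distrib_left times_divide_eq_right)
    ultimately have "((\<lambda>w. E_log (\<phi> w)) has_derivative G w) (at w)" by (simp add: E_log_eq)
    then show ?thesis
      by (rule has_derivative_transform_within_open[OF _ opW w]) (use g WU in auto)
  qed
  \<comment> \<open>differentiating \<open>|\<phi>\<^sub>i|\<^sup>2 = 1\<close> once\<close>
  have tan: "\<phi> w $ i \<bullet> ?D w h $ i = 0" if w: "w \<in> U" for w i h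
  proof -
    have "((\<lambda>w. \<phi> w $ i \<bullet> \<phi> w $ i) has_derivative
        (\<lambda>h. \<phi> w $ i \<bullet> ?D w h $ i + ?D w h $ i \<bullet> \<phi> w $ i)) (at w)"
      by (intro has_derivative_inner der_i w)
    moreover have "((\<lambda>w. \<phi> w $ i \<bullet> \<phi> w $ i) has_derivative (\<lambda>h. 0)) (at w)"
      by (rule has_derivative_transform_within_open[OF has_derivative_const[of 1] U(1) w])
        (use sph in \<open>auto simp: sphere_tuples_def norm_eq_1\<close>)
    ultimately have "\<phi> w $ i \<bullet> ?D w h $ i + ?D w h $ i \<bullet> \<phi> w $ i = 0"
      by (rule fun_cong[OF has_derivative_unique])
    then show ?thesis by (simp add: inner_commute)
  qed
  show "frechet_derivative \<phi> (at u) h \<in> tangent (\<phi> u)"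
    using tan[OF U(2)] by (simp add: tangent_def inner_commute)
  have "G u h = 0" for h
    unfolding G_def stationary_pairing[OF stat] using tan[OF U(2)] by simp
  then show "(g has_derivative (\<lambda>_. 0)) (at u)"
    using gD[OF uW] by (metis ext)
  define e where "e = (axis j 1 :: real^'n)"
  define D2 where "D2 = frechet_derivative (\<lambda>w. ?D w e) (at u)"
  have der2: "((\<lambda>w. ?D w e) has_derivative D2) (at u)"
    unfolding D2_def by (rule smooth_on_has_derivative[OF smooth_on_frechet_derivative[OF sm] U(2)])
  have der2_i: "((\<lambda>w. ?D w e $ i) has_derivative (\<lambda>h. D2 h $ i)) (at u)" for i
    by (rule bounded_linear.has_derivative[OF bounded_linear_vec_nth der2])
  \<comment> \<open>differentiating \<open>|\<phi>\<^sub>i|\<^sup>2 = 1\<close> twice\<close>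
  have acc: "\<phi> u $ i \<bullet> D2 h $ i = - (?D u h $ i \<bullet> ?D u e $ i)" for h i
  proof -
    have "((\<lambda>w. \<phi> w $ i \<bullet> ?D w e $ i) has_derivative
        (\<lambda>h. \<phi> u $ i \<bullet> D2 h $ i + ?D u h $ i \<bullet> ?D u e $ i)) (at u)"
      by (intro has_derivative_inner der_i der2_i U)
    moreover have "((\<lambda>w. \<phi> w $ i \<bullet> ?D w e $ i) has_derivative (\<lambda>h. 0)) (at u)"
      by (rule has_derivative_transform_within_open[OF has_derivative_const[of 0] U])
        (use tan in auto)
    ultimately have "\<phi> u $ i \<bullet> D2 h $ i + ?D u h $ i \<bullet> ?D u e $ i = 0"
      by (rule fun_cong[OF has_derivative_unique])
    then show ?thesis by simp
  qed
  have "((\<lambda>w. ?z i j w \<bullet> (?D w e $ i - ?D w e $ j) / (?z i j w \<bullet> ?z i j w)) has_derivative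
      (\<lambda>h. ((?D u h $ i - ?D u h $ j) \<bullet> (?D u e $ i - ?D u e $ j) + ?z i j u \<bullet> (D2 h $ i - D2 h $ j))
             / (?z i j u \<bullet> ?z i j u)
          - 2 * ((?z i j u \<bullet> (?D u h $ i - ?D u h $ j)) * (?z i j u \<bullet> (?D u e $ i - ?D u e $ j)))
             / (?z i j u \<bullet> ?z i j u)\<^sup>2)) (at u)" for i j
    using z0[OF uW, of i j] U
    by (cases "i = j") (auto intro!: has_derivative_inner_quotient der_z has_derivative_diff der2_i)
  then have "((\<lambda>w. G w e) has_derivative
      (\<lambda>h. - (\<Sum>i\<in>UNIV. \<Sum>j\<in>UNIV. ((?D u h $ i - ?D u h $ j) \<bullet> (?D u e $ i - ?D u e $ j) + ?z i j u \<bullet> (D2 h $ i - D2 h $ j))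
             / (?z i j u \<bullet> ?z i j u)
          - 2 * ((?z i j u \<bullet> (?D u h $ i - ?D u h $ j)) * (?z i j u \<bullet> (?D u e $ i - ?D u e $ j)))
             / (?z i j u \<bullet> ?z i j u)\<^sup>2))) (at u)"
    unfolding G_def by (intro has_derivative_minus has_derivative_sum) auto
  moreover have "- (\<Sum>i\<in>UNIV. \<Sum>j\<in>UNIV. ((?D u h $ i - ?D u h $ j) \<bullet> (?D u e $ i - ?D u e $ j) + ?z i j u \<bullet> (D2 h $ i - D2 h $ j))
             / (?z i j u \<bullet> ?z i j u)
          - 2 * ((?z i j u \<bullet> (?D u h $ i - ?D u h $ j)) * (?z i j u \<bullet> (?D u e $ i - ?D u e $ j)))
             / (?z i j u \<bullet> ?z i j u)\<^sup>2) = hess_form (\<phi> u) (?D u h) (?D u e)" for h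
    using stationary_pairing[OF stat, of "D2 h"] acc[of _ h]
    unfolding hess_form_def
    by (simp add: sum.distrib sum_subtractf add_divide_distrib sum_negf sum_distrib_left)
  ultimately have "((\<lambda>w. G w e) has_derivative (\<lambda>h. hess_form (\<phi> u) (?D u h) (?D u e))) (at u)"
    by simp
  then have "((\<lambda>w. frechet_derivative g (at w) e) has_derivative
      (\<lambda>h. hess_form (\<phi> u) (?D u h) (?D u e))) (at u)"
    by (rule has_derivative_transform_within_open[OF _ opW uW]) (metis gD frechet_derivative_at)
  then show "hessian g u $ i $ j =
       hess_form (\<phi> u) (frechet_derivative \<phi> (at u) (axis i 1)) (frechet_derivative \<phi> (at u) (axis j 1))"
    unfolding hessian_def e_def by (simp add: frechet_derivative_at[symmetric])
qed

section \<open>The Morse index from the tangential Hessian form\<close>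

lemma hessian_quadratic_form:
  assumes "linear D" and H: "\<And>i j. H $ i $ j = hess_form X (D (axis i 1)) (D (axis j 1))"
  shows "transpose H = H" "x \<bullet> (H *v y) = hess_form X (D x) (D y)"
proof -
  show "transpose H = H" by (simp add: vec_eq_iff transpose_def H hess_form_commute)
  have exp: "D x = (\<Sum>i\<in>UNIV. x $ i *\<^sub>R D (axis i 1))" for x
  proof -
    have "D x = D (\<Sum>i\<in>UNIV. x $ i *s axis i 1)" by (simp add: basis_expansion)
    then show ?thesis using assms(1) by (simp add: linear_sum linear_cmul scalar_mult_eq_scaleR)
  qed
  have "hess_form X (D x) (D y)
      = (\<Sum>i\<in>UNIV. \<Sum>j\<in>UNIV. hess_form X (x $ i *\<^sub>R D (axis i 1)) (y $ j *\<^sub>R D (axis j 1)))"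
    unfolding exp[of x] exp[of y] bilinear_sum[OF bilinear_hess_form] sum.cartesian_product ..
  then show "x \<bullet> (H *v y) = hess_form X (D x) (D y)"
    by (simp add: bilinear_lmul[OF bilinear_hess_form] bilinear_rmul[OF bilinear_hess_form]
        inner_vec_def matrix_vector_mult_def H sum_distrib_left mult_ac)
qed

lemma dim_tangent:
  assumes "X \<in> sphere_tuples"
  shows "dim (tangent X) = 10"
proof -
  have nX: "norm (X $ i) = 1" for i using assms by (simp add: sphere_tuples_def)
  have XX: "X $ i \<bullet> X $ i = 1" for i using nX[of i] by (simp add: norm_eq_1)
  define B where "B = range (\<lambda>i. axis i (X $ i))"
  have axis_dot: "axis i a \<bullet> v = a \<bullet> v $ i" for i :: 5 and a :: "real^3" and v :: "real^3^5"
    by (metis inner_axis inner_commute)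
  have ax: "axis i (X $ i) \<bullet> axis j (X $ j) = (if i = j then 1 else 0)" for i j
    using XX by (simp add: axis_dot) (simp add: axis_def)
  have "pairwise orthogonal B" "0 \<notin> B"
    using ax XX by (auto simp: B_def pairwise_def orthogonal_def)
      (metis inner_zero_left zero_neq_one)
  then have "dim (span B) = card B"
    by (metis dim_span_eq_card_independent pairwise_orthogonal_independent)
  also have "\<dots> = 5"
    unfolding B_def using ax by (subst card_image) (auto intro!: inj_onI, metis zero_neq_one)
  finally have dB: "dim (span B) = 5" .
  have "tangent X = {v. \<forall>w\<in>span B. orthogonal w v}"
  proof -
    have "orthogonal w v" if "v \<in> tangent X" "w \<in> span B" for v w
    proof -
      have "orthogonal v b" if "b \<in> B" for b
        using \<open>v \<in> tangent X\<close> that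
        by (auto simp: tangent_def B_def orthogonal_def inner_axis)
      then show ?thesis using orthogonal_to_span[OF that(2)] orthogonal_commute by blast
    qed
    moreover have "v \<in> tangent X" if "\<forall>w\<in>span B. orthogonal w v" for v
    proof -
      have "axis i (X $ i) \<bullet> v = 0" for i
        using that by (auto simp: B_def orthogonal_def span_base)
      then show ?thesis unfolding axis_dot by (simp add: tangent_def inner_commute)
    qed
    ultimately show ?thesis by blast
  qed
  then show ?thesis
    using dim_subspace_orthogonal_to_vectors[of "span B" UNIV] dB by simp
qed

lemma skew_cross_matrix:
  fixes w :: "real^3"
  obtains A where "transpose A = - A" "\<And>x. A *v x = w \<times> x"
proof
  show "transpose (matrix (\<lambda>x. w \<times> x)) = - matrix (\<lambda>x. w \<times> x)"
    by (simp add: vec_eq_iff forall_3 matrix_def transpose_def cross3_def axis_def)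
  show "matrix (\<lambda>x. w \<times> x) *v x = w \<times> x" for x
    by (simp add: vec_eq_iff forall_3 matrix_def matrix_vector_mult_def sum_3 cross3_def axis_def)
qed

text \<open>The sum of the seven-dimensional image of the differential and the three-dimensional space of
  infinitesimal rotations is direct by transversality, hence fills the tangent space, of dimension \<open>10\<close>.\<close>

lemma chart_splitting:
  fixes \<phi> :: "real^7 \<Rightarrow> real^3^5"
  assumes \<phi>: "conf_param U \<phi>" "u \<in> U"
    and tan: "\<And>h. frechet_derivative \<phi> (at u) h \<in> tangent (\<phi> u)"
  obtains \<pi> :: "real^3^5 \<Rightarrow> real^7" where "linear \<pi>"
    "\<And>v. v \<in> tangent (\<phi> u) \<Longrightarrow>
       \<exists>A. transpose A = - A \<and> v = frechet_derivative \<phi> (at u) (\<pi> v) + act A (\<phi> u)"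
proof -
  let ?D = "frechet_derivative \<phi> (at u)"
  have sm: "smooth_on U \<phi>" and sph: "\<phi> u \<in> sphere_tuples"
    and tr: "\<And>h A. transpose A = - A \<Longrightarrow> ?D h = act A (\<phi> u) \<Longrightarrow> h = 0 \<and> A = 0"
    using \<phi> unfolding conf_param_def by blast+
  have linD: "linear ?D" using smooth_on_has_derivative[OF sm \<phi>(2)] has_derivative_linear by blast
  define R where "R w = (\<chi> i. w \<times> \<phi> u $ i)" for w
  have R: "\<exists>A. transpose A = - A \<and> R w = act A (\<phi> u) \<and> (\<forall>x. A *v x = w \<times> x)" for w
  proof -
    obtain A where A: "transpose A = - A" "\<And>x. A *v x = w \<times> x" using skew_cross_matrix[of w] by blast
    then have "R w = act A (\<phi> u)" by (simp add: R_def vec_eq_iff[of "R w"] vec_eq_iff[of "vec_lambda _"])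
    with A show ?thesis by blast
  qed
  define M where "M x = ?D (fst x) + R (snd x)" for x
  have linM: "linear M"
    using linD unfolding M_def R_def
    by (simp add: linear_iff vec_eq_iff cross_add_left cross_mult_left algebra_simps)
  have injM: "inj M"
  proof (rule linear_injective_0[OF linM, THEN iffD2], intro allI impI)
    fix x assume "M x = 0"
    obtain A where A: "transpose A = - A" "R (- snd x) = act A (\<phi> u)" "\<And>y. A *v y = (- snd x) \<times> y"
      using R by blast
    have "?D (fst x) = R (- snd x)"
      using \<open>M x = 0\<close> by (simp add: M_def R_def vec_eq_iff eq_neg_iff_add_eq_0)
    then have 0: "fst x = 0" "A = 0" using tr[OF A(1)] A(2) by auto
    then have "snd x \<times> y = 0" for y using A(3)[of y] by simp
    then have "snd x \<times> axis 1 1 = 0" "snd x \<times> axis 2 1 = 0" by blast+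
    then have "snd x = 0" by (simp add: vec_eq_iff forall_3 cross3_def axis_def)
    then show "x = 0" using 0 by (simp add: prod_eq_iff)
  qed
  have subT: "subspace (tangent (\<phi> u))" by (auto simp: tangent_def subspace_def inner_simps)
  have "M x \<in> tangent (\<phi> u)" for x
    using tan[of "fst x"] by (simp add: M_def R_def tangent_def inner_simps dot_cross_self)
  moreover have "dim (range M) = DIM((real^7) \<times> (real^3))"
    using dim_image_eq[OF linM, of UNIV] injM by simp
  ultimately have range: "range M = tangent (\<phi> u)"
    using dim_tangent[OF sph] subT linM
    by (intro subspace_dim_equal) (auto intro: linear_subspace_image)
  obtain N where N: "linear N" "N \<circ> M = id" using linear_injective_left_inverse[OF linM injM] by blast
  show thesis
  proof (rule that[of "\<lambda>v. fst (N v)"])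
    show "linear (\<lambda>v. fst (N v))" using linear_compose[OF N(1) linear_fst] by (simp add: o_def)
  next
    show "\<exists>A. transpose A = - A \<and> v = ?D (fst (N v)) + act A (\<phi> u)" if "v \<in> tangent (\<phi> u)" for v
    proof -
      have "v \<in> range M" unfolding range by (rule that)
      then obtain x where x: "v = M x" by (rule rangeE)
      have "N (M x) = x" using fun_cong[OF N(2), of x] by simp
      then have v: "v = ?D (fst (N v)) + R (snd (N v))" unfolding x by (simp add: M_def[of x])
      obtain A where "transpose A = - A" "R (snd (N v)) = act A (\<phi> u)" using R by blast
      with v show ?thesis by auto
    qed
  qed
qed

text \<open>By \<open>hess_form_rotation\<close> the form on the tangent space is not changed by the projection along the orbit,
  so both test maps can be transported to the coordinate space of any chart.  The choice of \<open>S\<close> inside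
  the Euclidean space of the test maps also covers index \<open>0\<close>, with \<open>S = {0}\<close>.\<close>

lemma has_morse_index_criterion:
  fixes X :: "real^3^5" and L :: "real^3^5 \<Rightarrow> 'b::euclidean_space"
  assumes X: "X \<in> sphere_tuples" "inj (\<lambda>i. X $ i)" "X $ p \<times> X $ q \<noteq> 0"
    and stat: "stationary X" and S: "subspace S"
    and L: "linear L" "range L \<subseteq> S"
      "\<And>v. v \<in> tangent X \<Longrightarrow> L v = 0 \<Longrightarrow> hess_form X v v \<ge> 0"
    and J: "linear J" "range J \<subseteq> tangent X"
      "\<And>y. y \<in> S \<Longrightarrow> y \<noteq> 0 \<Longrightarrow> hess_form X (J y) (J y) < 0"
  shows "has_morse_index E_log_conf (conf_class X) (dim S)"
proof -
  have *: "(\<exists>W. open W \<and> u \<in> W \<and> smooth_on W g) \<and> (g has_derivative (\<lambda>_. 0)) (at u) \<and>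
      neg_index (hessian g u) = dim S"
    if c: "conf_param U \<psi>" "u \<in> U" and u: "conf_class (\<psi> u) = conf_class X"
      and g: "g = (\<lambda>w. E_log_conf (conf_class (\<psi> w)))" for U \<psi> u g
  proof -
    have "\<psi> u \<in> sphere_tuples" using c unfolding conf_param_def by blast
    then obtain Q where Q: "rotation_matrix Q" "X = act Q (\<psi> u)"
      using conf_class_eqD[OF u] X(1) by blast
    define \<phi> where "\<phi> w = act Q (\<psi> w)" for w
    have \<phi>: "conf_param U \<phi>" unfolding \<phi>_def by (rule conf_param_act[OF c(1) Q(1)])
    have \<phi>u: "\<phi> u = X" by (simp add: \<phi>_def Q(2))
    have U: "open U" "smooth_on U \<phi>" "\<And>w. w \<in> U \<Longrightarrow> \<phi> w \<in> sphere_tuples"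
      using \<phi> unfolding conf_param_def by blast+
    have gE: "g w = E_log (\<phi> w)" if "w \<in> U" for w
    proof -
      have "\<psi> w \<in> sphere_tuples" using c(1) that unfolding conf_param_def by blast
      then show ?thesis by (simp add: g E_log_conf_class \<phi>_def E_log_act Q(1))
    qed
    have "inj (\<lambda>i. \<phi> u $ i)" "stationary (\<phi> u)" using X(2) stat by (simp_all add: \<phi>u)
    from energy_second_variation[OF U(1) c(2) U(2) U(3) this gE]
    have var: "\<exists>W. open W \<and> u \<in> W \<and> smooth_on W g" "(g has_derivative (\<lambda>_. 0)) (at u)"
      "frechet_derivative \<phi> (at u) h \<in> tangent X"
      "hessian g u $ i $ j = hess_form X (frechet_derivative \<phi> (at u) (axis i 1))
          (frechet_derivative \<phi> (at u) (axis j 1))" for h i j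
      unfolding \<phi>u by blast+
    let ?D = "frechet_derivative \<phi> (at u)"
    have linD: "linear ?D" using smooth_on_has_derivative[OF U(2) c(2)] has_derivative_linear by blast
    have tan: "?D h \<in> tangent X" for h using var(3) by blast
    note H = hessian_quadratic_form[OF linD var(4)]
    obtain \<pi> :: "real^3^5 \<Rightarrow> real^7" where \<pi>: "linear \<pi>"
      "\<And>v. v \<in> tangent X \<Longrightarrow> \<exists>A. transpose A = - A \<and> v = ?D (\<pi> v) + act A X"
      using chart_splitting[OF \<phi> c(2)] tan unfolding \<phi>u by blast
    have form: "hess_form X v v = hess_form X (?D (\<pi> v)) (?D (\<pi> v))" if v: "v \<in> tangent X" for v
    proof -
      obtain A where A: "transpose A = - A" "v = ?D (\<pi> v) + act A X" using \<pi>(2)[OF v] by blast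
      have "hess_form X v v = hess_form X v (?D (\<pi> v)) + hess_form X v (act A X)"
        by (subst (2) A(2)) (rule bilinear_radd[OF bilinear_hess_form])
      also have "\<dots> = hess_form X (?D (\<pi> v)) v"
        by (simp add: hess_form_rotation[OF stat A(1)] hess_form_commute)
      also have "\<dots> = hess_form X (?D (\<pi> v)) (?D (\<pi> v)) + hess_form X (?D (\<pi> v)) (act A X)"
        by (subst (2) A(2)) (rule bilinear_radd[OF bilinear_hess_form])
      finally show ?thesis by (simp add: hess_form_rotation[OF stat A(1)])
    qed
    have "neg_index (hessian g u) = dim S"
    proof (rule neg_index_eq[OF H(1) S, of "\<lambda>h. L (?D h)" "\<lambda>y. \<pi> (J y)"])
      show "linear (\<lambda>h. L (?D h))" using linear_compose[OF linD L(1)] by (simp add: o_def)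
      show "linear (\<lambda>y. \<pi> (J y))" using linear_compose[OF J(1) \<pi>(1)] by (simp add: o_def)
      show "range (\<lambda>h. L (?D h)) \<subseteq> S" using L(2) by blast
      show "0 \<le> h \<bullet> (hessian g u *v h)" if "L (?D h) = 0" for h
        unfolding H(2) by (rule L(3)[OF tan that])
      show "\<pi> (J y) \<bullet> (hessian g u *v \<pi> (J y)) < 0" if "y \<in> S" "y \<noteq> 0" for y
      proof -
        have "J y \<in> tangent X" using J(2) by blast
        from form[OF this] show ?thesis using J(3)[OF that] unfolding H(2) by simp
      qed
    qed
    then show ?thesis using var(1,2) by blast
  qed
  have "conf_class X \<in> Conf"
    unfolding Conf_def conf_class_def using X(1) by (rule quotientI)
  moreover obtain U \<phi> u where "conf_param U \<phi>" "u \<in> U" "\<phi> u = X"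
    using exists_chart[OF X(1,3)] .
  ultimately show ?thesis
    unfolding has_morse_index_def Let_def using * by blast
qed

section \<open>Five points in coordinates\<close>

lemma vector_3_inner: "(vector [a, b, c] :: real^3) \<bullet> vector [d, e, f] = a * d + b * e + c * f"
  by (simp add: inner_vec_def sum_3)

lemma vector_3_diff: "(vector [a, b, c] :: real^3) - vector [d, e, f] = vector [a - d, b - e, c - f]"
  by (simp add: vec_eq_iff forall_3)

lemma vector_3_add: "(vector [a, b, c] :: real^3) + vector [d, e, f] = vector [a + d, b + e, c + f]"
  by (simp add: vec_eq_iff forall_3)

lemma vector_3_scaleR: "r *\<^sub>R (vector [a, b, c] :: real^3) = vector [r * a, r * b, r * c]"
  by (simp add: vec_eq_iff forall_3)

lemma vector_3_eq_iff: "(vector [a, b, c] :: real^3) = vector [d, e, f] \<longleftrightarrow> a = d \<and> b = e \<and> c = f"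
  by (simp add: vec_eq_iff forall_3)

lemma vector_3_eq_0_iff: "(vector [a, b, c] :: real^3) = 0 \<longleftrightarrow> a = 0 \<and> b = 0 \<and> c = 0"
  by (simp add: vec_eq_iff forall_3)

lemma vector_3_exhaust:
  fixes v :: "real^3"
  obtains x y z where "v = vector [x, y, z]"
  by (rule that[of "v $ 1" "v $ 2" "v $ 3"]) (simp add: vec_eq_iff forall_3)

lemma cross3_vector:
  "(vector [a, b, c] :: real^3) \<times> vector [d, e, f] = vector [b * f - c * e, c * d - a * f, a * e - b * d]"
  by (simp add: cross3_def vec_eq_iff forall_3)

lemmas vector_3_simps = vector_3_inner vector_3_diff vector_3_add vector_3_scaleR
  vector_3_eq_iff vector_3_eq_0_iff

lemma rotation_to_standard_frame:
  fixes a b :: "real^3"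
  assumes "norm a = 1" "norm b = 1" "a \<bullet> b = 0"
  obtains R where "rotation_matrix R"
    "\<And>y. R *v y = vector [a \<bullet> y, b \<bullet> y, (a \<times> b) \<bullet> y]"
proof
  let ?R = "vector [a, b, a \<times> b] :: real^3^3"
  have aa: "a \<bullet> a = 1" "b \<bullet> b = 1" "b \<bullet> a = 0" using assms by (simp_all add: norm_eq_1 inner_commute)
  have cc: "(a \<times> b) \<bullet> (a \<times> b) = 1"
    using norm_cross_dot[of a b] assms by (simp add: power2_norm_eq_inner)
  have "?R ** transpose ?R = mat 1"
    using aa cc assms
    by (simp add: vec_eq_iff forall_3 matrix_matrix_mult_def transpose_def mat_def sum_3
        inner_vec_def cross3_def algebra_simps)
  then have "orthogonal_matrix ?R"
    by (simp add: orthogonal_matrix_def matrix_left_right_inverse)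
  moreover have "det ?R = 1"
  proof -
    have "det ?R = a \<bullet> (b \<times> (a \<times> b))" by (simp add: dot_cross_det)
    also have "\<dots> = 1" by (simp add: Lagrange aa)
    finally show ?thesis .
  qed
  ultimately show "rotation_matrix ?R" by (simp add: rotation_matrix_def)
  show "?R *v y = vector [a \<bullet> y, b \<bullet> y, (a \<times> b) \<bullet> y]" for y
    by (simp add: vec_eq_iff forall_3 matrix_vector_mul_component)
qed

lemma enumerate_range_5:
  fixes f :: "5 \<Rightarrow> 'a"
  assumes "range f = {p0, p1, p2, p3, p4}" "distinct [p0, p1, p2, p3, p4]"
  obtains i0 i1 i2 i3 i4 where "distinct [i0, i1, i2, i3, i4]" "UNIV = {i0, i1, i2, i3, i4}"
    "f i0 = p0" "f i1 = p1" "f i2 = p2" "f i3 = p3" "f i4 = p4"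
proof -
  obtain i0 i1 i2 i3 i4 where i: "f i0 = p0" "f i1 = p1" "f i2 = p2" "f i3 = p3" "f i4 = p4"
    using assms(1) by (metis insertCI rangeE)
  then have d: "distinct [i0, i1, i2, i3, i4]" using assms(2) by auto
  then have "card {i0, i1, i2, i3, i4} = 5" by simp
  then have "{i0, i1, i2, i3, i4} = UNIV" by (intro card_subset_eq) auto
  then show thesis using that d i by metis
qed

lemma sum_enumerated_5:
  assumes "distinct [i0, i1, i2, i3, i4]" "UNIV = {i0, i1, i2, i3, i4 :: 'i}"
  shows "(\<Sum>i\<in>UNIV. f i) = f i0 + f i1 + f i2 + f i3 + (f i4 :: 'a::comm_monoid_add)"
  unfolding assms(2) using assms(1) by (simp add: add.assoc)

lemma inj_enumerated_5:
  assumes "UNIV = {i0, i1, i2, i3, i4 :: 'i}" "distinct [f i0, f i1, f i2, f i3, f i4]"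
  shows "inj f"
proof (rule injI)
  fix i j assume "f i = f j"
  moreover have "i \<in> {i0, i1, i2, i3, i4}" "j \<in> {i0, i1, i2, i3, i4}" using assms(1) by blast+
  ultimately show "i = j" using assms(2) by auto
qed

text \<open>The contribution of one pair of points to half of the second variation.\<close>

definition pair_term :: "real^3 \<Rightarrow> real^3 \<Rightarrow> real^3 \<Rightarrow> real^3 \<Rightarrow> real" where
  "pair_term x y v w = (v \<bullet> v + w \<bullet> w) / 2 - (v - w) \<bullet> (v - w) / ((x - y) \<bullet> (x - y))
     + 2 * ((x - y) \<bullet> (v - w))\<^sup>2 / ((x - y) \<bullet> (x - y))\<^sup>2"

text \<open>Each point belongs to four pairs, so the first sum of the form can be shared out equally among them.
  Each pair then contributes on its own, which keeps the computations below separate.\<close>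

lemma hess_form_pairs:
  fixes X v :: "real^3^5"
  assumes "distinct [i0, i1, i2, i3, i4]" "UNIV = {i0, i1, i2, i3, i4}"
  defines "k \<equiv> \<lambda>i j. pair_term (X $ i) (X $ j) (v $ i) (v $ j)"
  shows "hess_form X v v = 2 * (k i0 i1 + k i0 i2 + k i0 i3 + k i0 i4 + k i1 i2 + k i1 i3 + k i1 i4
           + k i2 i3 + k i2 i4 + k i3 i4)"
proof -
  define t where "t i j = - ((v $ i - v $ j) \<bullet> (v $ i - v $ j) / ((X $ i - X $ j) \<bullet> (X $ i - X $ j)))
     + 2 * ((X $ i - X $ j) \<bullet> (v $ i - v $ j))\<^sup>2 / ((X $ i - X $ j) \<bullet> (X $ i - X $ j))\<^sup>2" for i j
  have t0: "t i i = 0" for i by (simp add: t_def)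
  have sym: "t j i = t i j" for i j
  proof -
    have "v $ j - v $ i = - (v $ i - v $ j)" "X $ j - X $ i = - (X $ i - X $ j)" by simp_all
    then show ?thesis unfolding t_def by (simp only: inner_minus_left inner_minus_right minus_minus)
  qed
  have k: "k i j = (v $ i \<bullet> v $ i + v $ j \<bullet> v $ j) / 2 + t i j" for i j
    by (simp add: k_def pair_term_def t_def)
  have "hess_form X v v = 4 * (\<Sum>i\<in>UNIV. v $ i \<bullet> v $ i) + (\<Sum>i\<in>UNIV. \<Sum>j\<in>UNIV. t i j)"
    unfolding hess_form_def t_def
    by (simp add: sum.distrib sum_subtractf sum_negf sum_distrib_left power2_eq_square)
  also have "\<dots> = 4 * (\<Sum>i\<in>UNIV. v $ i \<bullet> v $ i) + 2 * (t i0 i1 + t i0 i2 + t i0 i3 + t i0 i4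
      + t i1 i2 + t i1 i3 + t i1 i4 + t i2 i3 + t i2 i4 + t i3 i4)"
    unfolding sum_enumerated_5[OF assms(1,2)] t0
    unfolding sym[of i0 i1] sym[of i0 i2] sym[of i0 i3] sym[of i0 i4] sym[of i1 i2] sym[of i1 i3]
      sym[of i1 i4] sym[of i2 i3] sym[of i2 i4] sym[of i3 i4] by simp
  finally show ?thesis
    unfolding k sum_enumerated_5[OF assms(1,2)] by (simp add: add_divide_distrib)
qed

lemma pair_term_vector:
  assumes "s = (x1 - y1)\<^sup>2 + (x2 - y2)\<^sup>2 + (x3 - y3)\<^sup>2"
  shows "pair_term (vector [x1, x2, x3]) (vector [y1, y2, y3]) (vector [v1, v2, v3]) (vector [w1, w2, w3])
    = (v1\<^sup>2 + v2\<^sup>2 + v3\<^sup>2 + w1\<^sup>2 + w2\<^sup>2 + w3\<^sup>2) / 2 - ((v1 - w1)\<^sup>2 + (v2 - w2)\<^sup>2 + (v3 - w3)\<^sup>2) / s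
      + 2 * ((x1 - y1) * (v1 - w1) + (x2 - y2) * (v2 - w2) + (x3 - y3) * (v3 - w3))\<^sup>2 / s\<^sup>2"
  by (simp add: pair_term_def vector_3_simps assms power2_eq_square)

section \<open>Points on the equator\<close>

text \<open>The chord is horizontal, so the vertical displacements \<open>b\<close> do not change its length to first order and
  decouple from the displacements \<open>a\<close> along the circle.\<close>

lemma equator_pair_term:
  fixes c s c' s' :: real
  assumes 1: "c * c + s * s = 1" "c' * c' + s' * s' = 1"
    and d: "d = 2 - 2 * (c * c' + s * s')" "d \<noteq> 0"
  shows "pair_term (vector [c, s, 0]) (vector [c', s', 0])
      (vector [- s * a, c * a, b]) (vector [- s' * a', c' * a', b'])
    = (a - a')\<^sup>2 / d + (b\<^sup>2 + b'\<^sup>2) / 2 - (b - b')\<^sup>2 / d"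
proof -
  define k where "k = c * c' + s * s'"
  define m where "m = c * s' - s * c'"
  have "k * k + m * m = (c * c + s * s) * (c' * c' + s' * s')"
    by (simp add: k_def m_def algebra_simps)
  then have km: "m * m = 1 - k * k" using 1 by simp
  have "d = 2 - 2 * k" unfolding k_def by (rule d(1))
  then have k: "k = 1 - d / 2" by (simp add: field_simps)
  have dd: "d = (c - c')\<^sup>2 + (s - s')\<^sup>2 + (0 - 0)\<^sup>2"
    using 1 d(1) by (simp add: power2_eq_square algebra_simps)
  have "(- s * a)\<^sup>2 + (c * a)\<^sup>2 = (c * c + s * s) * a\<^sup>2"
    "(- s' * a')\<^sup>2 + (c' * a')\<^sup>2 = (c' * c' + s' * s') * a'\<^sup>2"
    by (simp_all add: power2_eq_square algebra_simps)
  then have e1: "(- s * a)\<^sup>2 + (c * a)\<^sup>2 + b\<^sup>2 + (- s' * a')\<^sup>2 + (c' * a')\<^sup>2 + b'\<^sup>2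
      = a\<^sup>2 + a'\<^sup>2 + b\<^sup>2 + b'\<^sup>2" using 1 by simp
  have "(- s * a - - s' * a')\<^sup>2 + (c * a - c' * a')\<^sup>2
      = (c * c + s * s) * a\<^sup>2 + (c' * c' + s' * s') * a'\<^sup>2 - 2 * a * a' * k"
    by (simp add: k_def power2_eq_square algebra_simps)
  then have e2: "(- s * a - - s' * a')\<^sup>2 + (c * a - c' * a')\<^sup>2 + (b - b')\<^sup>2
      = a\<^sup>2 + a'\<^sup>2 - 2 * a * a' * k + (b - b')\<^sup>2" using 1 by simp
  have "(c - c') * (- s * a - - s' * a') + (s - s') * (c * a - c' * a') + (0 - 0) * (b - b')
      = m * (a' - a)"
    by (simp add: m_def algebra_simps)
  then have e3: "((c - c') * (- s * a - - s' * a') + (s - s') * (c * a - c' * a') + (0 - 0) * (b - b'))\<^sup>2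
      = (1 - k * k) * (a' - a)\<^sup>2"
    using km by (simp add: power_mult_distrib power2_eq_square)
  show ?thesis
    unfolding pair_term_vector[OF dd] e1 e2 e3 k using d(2)
    by (simp add: field_simps power2_eq_square)
qed

text \<open>The number \<open>c * y - s * x\<close> is the angular velocity, the horizontal coordinate of a displacement in the
  computations below.\<close>

lemma tangent_circle:
  fixes c s x y :: real
  assumes "c * c + s * s = 1" "x * c + y * s = 0"
  shows "x = - s * (c * y - s * x)" "y = c * (c * y - s * x)"
  using assms by algebra+

section \<open>The triangular bipyramid\<close>

text \<open>In terms of \<open>P = p + m\<close> and \<open>M = p - m\<close> for the motions \<open>p\<close>, \<open>m\<close> of the two poles, the horizontal motions \<open>a\<close>
  interact only with \<open>P\<close>, and the vertical motions \<open>b\<close> of the equatorial points only with \<open>M\<close>.  Completing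
  squares in both groups exhibits the form as a sum of squares.\<close>

lemma bipyramid_index:
  fixes h :: real
  assumes h: "h * h = 3 / 4"
    and D: "distinct [i0, i1, i2, i3, i4]" and U: "UNIV = {i0, i1, i2, i3, i4}"
    and X: "X $ i0 = vector [0, 0, 1]" "X $ i1 = vector [0, 0, - 1]" "X $ i2 = vector [1, 0, 0]"
      "X $ i3 = vector [- 1 / 2, h, 0]" "X $ i4 = vector [- 1 / 2, - h, 0]"
  shows "has_morse_index E_log_conf (conf_class X) 0"
proof -
  have all: "(\<forall>i. P i) \<longleftrightarrow> P i0 \<and> P i1 \<and> P i2 \<and> P i3 \<and> P i4" for P
    using U by (metis UNIV_I insertE singletonD)
  have h0: "h \<noteq> 0" using h by auto
  have hh: "h * (h * x) = 3 / 4 * x" for x using h by (metis mult.assoc)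
  have sph: "X \<in> sphere_tuples"
    using h by (simp add: sphere_tuples_def all X norm_eq_1 vector_3_simps)
  have inj: "inj (\<lambda>i. X $ i)"
    using h0 by (intro inj_enumerated_5[OF U]) (simp add: X vector_3_simps)
  have cross: "X $ i0 \<times> X $ i2 \<noteq> 0"
    by (simp add: X cross3_vector vector_3_simps)
  have stat: "stationary X"
    unfolding stationary_def all sum_enumerated_5[OF D U] X using h
    by (simp add: vector_3_simps) (simp add: field_simps)
  have form: "hess_form X v v
      = 2 * ((a2 - (a2 + a3 + a4) / 3 + (p2 + m2) / 2)\<^sup>2
           + (a3 - (a2 + a3 + a4) / 3 - (h * (p1 + m1) + (p2 + m2) / 2) / 2)\<^sup>2
           + (a4 - (a2 + a3 + a4) / 3 + (h * (p1 + m1) - (p2 + m2) / 2) / 2)\<^sup>2)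
       + ((p1 + m1)\<^sup>2 + (p2 + m2)\<^sup>2) / 2 + 2 / 3 * (b2 + b3 + b4)\<^sup>2
       + ((p1 - m1 + 2 * b2)\<^sup>2
          + (- (p1 - m1) / 2 + h * (p2 - m2) + 2 * b3)\<^sup>2
          + (- (p1 - m1) / 2 - h * (p2 - m2) + 2 * b4)\<^sup>2) / 2"
    if "v $ i0 = vector [p1, p2, 0]" "v $ i1 = vector [m1, m2, 0]"
      "v $ i2 = vector [- 0 * a2, 1 * a2, b2]" "v $ i3 = vector [- h * a3, - 1 / 2 * a3, b3]"
      "v $ i4 = vector [- (- h) * a4, - 1 / 2 * a4, b4]"
    for v p1 p2 m1 m2 a2 b2 a3 b3 a4 b4
  proof -
    have "pair_term (X $ i0) (X $ i1) (v $ i0) (v $ i1) = ((p1 + m1)\<^sup>2 + (p2 + m2)\<^sup>2) / 4"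
      unfolding X that
      by (subst pair_term_vector[of "4"])
        (simp_all add: h hh power2_eq_square algebra_simps add_divide_distrib diff_divide_distrib)
    moreover have "pair_term (X $ i0) (X $ i2) (v $ i0) (v $ i2) = a2 * p2 + (p1 + b2)\<^sup>2 / 2"
      unfolding X that
      by (subst pair_term_vector[of "2"])
        (simp_all add: h hh power2_eq_square algebra_simps add_divide_distrib diff_divide_distrib)
    moreover have "pair_term (X $ i0) (X $ i3) (v $ i0) (v $ i3)
        = - a3 * (h * p1 + p2 / 2) + (- p1 / 2 + h * p2 + b3)\<^sup>2 / 2"
      unfolding X that
      by (subst pair_term_vector[of "2"])
        (simp_all add: h hh power2_eq_square algebra_simps add_divide_distrib diff_divide_distrib)
    moreover have "pair_term (X $ i0) (X $ i4) (v $ i0) (v $ i4)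
        = a4 * (h * p1 - p2 / 2) + (- p1 / 2 - h * p2 + b4)\<^sup>2 / 2"
      unfolding X that
      by (subst pair_term_vector[of "2"])
        (simp_all add: h hh power2_eq_square algebra_simps add_divide_distrib diff_divide_distrib)
    moreover have "pair_term (X $ i1) (X $ i2) (v $ i1) (v $ i2) = a2 * m2 + (m1 - b2)\<^sup>2 / 2"
      unfolding X that
      by (subst pair_term_vector[of "2"])
        (simp_all add: h hh power2_eq_square algebra_simps add_divide_distrib diff_divide_distrib)
    moreover have "pair_term (X $ i1) (X $ i3) (v $ i1) (v $ i3)
        = - a3 * (h * m1 + m2 / 2) + (- m1 / 2 + h * m2 - b3)\<^sup>2 / 2"
      unfolding X that
      by (subst pair_term_vector[of "2"])
        (simp_all add: h hh power2_eq_square algebra_simps add_divide_distrib diff_divide_distrib)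
    moreover have "pair_term (X $ i1) (X $ i4) (v $ i1) (v $ i4)
        = a4 * (h * m1 - m2 / 2) + (- m1 / 2 - h * m2 - b4)\<^sup>2 / 2"
      unfolding X that
      by (subst pair_term_vector[of "2"])
        (simp_all add: h hh power2_eq_square algebra_simps add_divide_distrib diff_divide_distrib)
    moreover have "pair_term (X $ i2) (X $ i3) (v $ i2) (v $ i3)
        = (a2 - a3)\<^sup>2 / 3 + (b2\<^sup>2 + b3\<^sup>2) / 2 - (b2 - b3)\<^sup>2 / 3"
      "pair_term (X $ i2) (X $ i4) (v $ i2) (v $ i4)
        = (a2 - a4)\<^sup>2 / 3 + (b2\<^sup>2 + b4\<^sup>2) / 2 - (b2 - b4)\<^sup>2 / 3"
      "pair_term (X $ i3) (X $ i4) (v $ i3) (v $ i4)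
        = (a3 - a4)\<^sup>2 / 3 + (b3\<^sup>2 + b4\<^sup>2) / 2 - (b3 - b4)\<^sup>2 / 3"
      unfolding X that using h by (intro equator_pair_term; simp)+
    ultimately show ?thesis
      unfolding hess_form_pairs[OF D U]
      by (simp add: h hh power2_eq_square algebra_simps add_divide_distrib diff_divide_distrib)
  qed
  have "has_morse_index E_log_conf (conf_class X) (dim {0 :: real})"
  proof (rule has_morse_index_criterion[OF sph inj cross stat, of _ "\<lambda>_. 0" "\<lambda>_. 0"])
    show "0 \<le> hess_form X v v" if v: "v \<in> tangent X" for v
    proof -
      obtain x0 y0 z0 where v0: "v $ i0 = vector [x0, y0, z0]" by (rule vector_3_exhaust)
      obtain x1 y1 z1 where v1: "v $ i1 = vector [x1, y1, z1]" by (rule vector_3_exhaust)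
      obtain x2 y2 z2 where v2: "v $ i2 = vector [x2, y2, z2]" by (rule vector_3_exhaust)
      obtain x3 y3 z3 where v3: "v $ i3 = vector [x3, y3, z3]" by (rule vector_3_exhaust)
      obtain x4 y4 z4 where v4: "v $ i4 = vector [x4, y4, z4]" by (rule vector_3_exhaust)
      note vs = v0 v1 v2 v3 v4
      have t: "z0 = 0" "z1 = 0" "x2 * 1 + y2 * 0 = 0" "x3 * (- 1 / 2) + y3 * h = 0"
        "x4 * (- 1 / 2) + y4 * (- h) = 0"
        using v(1) by (simp_all add: tangent_def all X vs vector_3_simps field_simps)
      have n: "(1::real) * 1 + 0 * 0 = 1" "(- 1 / 2) * (- 1 / 2) + h * h = 1" "(- 1 / 2) * (- 1 / 2) + (- h) * (- h) = 1"
        using h by simp_all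
      have "v $ i0 = vector [x0, y0, 0]" "v $ i1 = vector [x1, y1, 0]" using vs t by simp_all
      note f = form[OF this]
      note c2 = tangent_circle[OF n(1) t(3)] and c3 = tangent_circle[OF n(2) t(4)] and c4 = tangent_circle[OF n(3) t(5)]
      have "\<exists>a2 a3 a4. v $ i2 = vector [- 0 * a2, 1 * a2, z2] \<and> v $ i3 = vector [- h * a3, - 1 / 2 * a3, z3]
          \<and> v $ i4 = vector [- (- h) * a4, - 1 / 2 * a4, z4]"
        unfolding vs vector_3_eq_iff using c2 c3 c4 by blast
      then obtain a2 a3 a4 where "v $ i2 = vector [- 0 * a2, 1 * a2, z2]" "v $ i3 = vector [- h * a3, - 1 / 2 * a3, z3]"
          "v $ i4 = vector [- (- h) * a4, - 1 / 2 * a4, z4]" by blast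
      from f[OF this] show ?thesis by simp
    qed
  qed (auto simp: tangent_def linear_iff)
  then show ?thesis by simp
qed

section \<open>The square pyramid\<close>

text \<open>Here \<open>a\<close> is the motion of a base point along its horizontal circle, \<open>b\<close> its motion along the meridian, \<open>p\<close> the motion of the apex.  The
  reflections of the square separate the combinations \<open>b1 + b3\<close>, \<open>b1 - b3\<close>, \<open>a1 + a3\<close>, \<open>a1 - a3\<close> and so
  on, and the form is a combination of squares in them with a single negative coefficient.\<close>

lemma pyramid_index:
  fixes r :: real
  assumes r: "r > 0" "r * r = 15 / 16"
    and D: "distinct [i0, i1, i2, i3, i4]" and U: "UNIV = {i0, i1, i2, i3, i4}"
    and X: "X $ i0 = vector [0, 0, 1]" "X $ i1 = vector [r, 0, - 1 / 4]" "X $ i2 = vector [0, r, - 1 / 4]"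
      "X $ i3 = vector [- r, 0, - 1 / 4]" "X $ i4 = vector [0, - r, - 1 / 4]"
  shows "has_morse_index E_log_conf (conf_class X) 1"
proof -
  have all: "(\<forall>i. P i) \<longleftrightarrow> P i0 \<and> P i1 \<and> P i2 \<and> P i3 \<and> P i4" for P
    using U by (metis UNIV_I insertE singletonD)
  have r0: "r \<noteq> 0" using r by simp
  have rr: "r * (r * x) = 15 / 16 * x" for x using r(2) by (metis mult.assoc)
  have sph: "X \<in> sphere_tuples"
    using r by (simp add: sphere_tuples_def all X norm_eq_1 vector_3_simps)
  have inj: "inj (\<lambda>i. X $ i)"
    using r by (intro inj_enumerated_5[OF U]) (simp add: X vector_3_simps)
  have cross: "X $ i1 \<times> X $ i2 \<noteq> 0"
    using r0 by (simp add: X cross3_vector vector_3_simps)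
  have stat: "stationary X"
    unfolding stationary_def all sum_enumerated_5[OF D U] X using r
    by (simp add: vector_3_simps) (simp add: field_simps)
  define z where "z v i = v $ i $ 3" for v :: "real^3^5" and i
  define L where "L v = z v i1 - z v i2 + z v i3 - z v i4" for v
  define V :: "real^3^5" where
    "V = (\<chi> i. if i = i0 then 0 else if i = i1 then vector [1 / 4, 0, r]
       else if i = i2 then vector [0, - 1 / 4, - r] else if i = i3 then vector [- 1 / 4, 0, r]
       else vector [0, 1 / 4, - r])"
  have form: "hess_form X v v = (b1 + b2 + b3 + b4)\<^sup>2 - (b1 - b2 + b3 - b4)\<^sup>2 / 15
       + 2 / 5 * (b1 - b3 + 2 * p1)\<^sup>2 + 2 / 5 * (b2 - b4 + 2 * p2)\<^sup>2
       + 16 / 15 * (a1 - a3 + a2 - a4)\<^sup>2 + 2 / 5 * (2 * (a1 + a3) + p2)\<^sup>2 + 2 / 5 * (2 * (a2 + a4) + p1)\<^sup>2"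
    if "v $ i0 = vector [p1, p2, 0]" "v $ i1 = vector [b1 / 4, a1, r * b1]"
      "v $ i2 = vector [a2, b2 / 4, r * b2]" "v $ i3 = vector [- b3 / 4, a3, r * b3]"
      "v $ i4 = vector [a4, - b4 / 4, r * b4]"
    for v p1 p2 b1 a1 a2 b2 b3 a3 a4 b4
  proof -
    have "pair_term (X $ i0) (X $ i1) (v $ i0) (v $ i1)
        = 2 / 5 * (b1 + p1)\<^sup>2 + (p2\<^sup>2 + a1\<^sup>2) / 10 + 4 / 5 * (p2 * a1)"
      unfolding X that
      by (subst pair_term_vector[of "5 / 2"])
        (simp_all add: r rr power2_eq_square algebra_simps add_divide_distrib diff_divide_distrib)
    moreover have "pair_term (X $ i0) (X $ i2) (v $ i0) (v $ i2)
        = 2 / 5 * (b2 + p2)\<^sup>2 + (p1\<^sup>2 + a2\<^sup>2) / 10 + 4 / 5 * (p1 * a2)"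
      unfolding X that
      by (subst pair_term_vector[of "5 / 2"])
        (simp_all add: r rr power2_eq_square algebra_simps add_divide_distrib diff_divide_distrib)
    moreover have "pair_term (X $ i0) (X $ i3) (v $ i0) (v $ i3)
        = 2 / 5 * (b3 - p1)\<^sup>2 + (p2\<^sup>2 + a3\<^sup>2) / 10 + 4 / 5 * (p2 * a3)"
      unfolding X that
      by (subst pair_term_vector[of "5 / 2"])
        (simp_all add: r rr power2_eq_square algebra_simps add_divide_distrib diff_divide_distrib)
    moreover have "pair_term (X $ i0) (X $ i4) (v $ i0) (v $ i4)
        = 2 / 5 * (b4 - p2)\<^sup>2 + (p1\<^sup>2 + a4\<^sup>2) / 10 + 4 / 5 * (p1 * a4)"
      unfolding X that
      by (subst pair_term_vector[of "5 / 2"])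
        (simp_all add: r rr power2_eq_square algebra_simps add_divide_distrib diff_divide_distrib)
    moreover have "pair_term (X $ i1) (X $ i2) (v $ i1) (v $ i2)
        = (a1\<^sup>2 + a2\<^sup>2) / 2 + 16 / 15 * (a1 * a2) - 4 / 15 * (a1 * b1) - 4 / 15 * (a2 * b2) + 16 / 15 * (b1 * b2)"
      unfolding X that
      by (subst pair_term_vector[of "15 / 8"])
        (simp_all add: r rr power2_eq_square algebra_simps add_divide_distrib diff_divide_distrib)
    moreover have "pair_term (X $ i1) (X $ i3) (v $ i1) (v $ i3)
        = 4 / 15 * (b1 + b3)\<^sup>2 + (a1 + a3)\<^sup>2 / 4 - (a1 - a3)\<^sup>2 / 60"
      unfolding X that
      by (subst pair_term_vector[of "15 / 4"])
        (simp_all add: r rr power2_eq_square algebra_simps add_divide_distrib diff_divide_distrib)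
    moreover have "pair_term (X $ i1) (X $ i4) (v $ i1) (v $ i4)
        = (a1\<^sup>2 + a4\<^sup>2) / 2 - 16 / 15 * (a1 * a4) + 4 / 15 * (a1 * b1) - 4 / 15 * (a4 * b4) + 16 / 15 * (b1 * b4)"
      unfolding X that
      by (subst pair_term_vector[of "15 / 8"])
        (simp_all add: r rr power2_eq_square algebra_simps add_divide_distrib diff_divide_distrib)
    moreover have "pair_term (X $ i2) (X $ i3) (v $ i2) (v $ i3)
        = (a3\<^sup>2 + a2\<^sup>2) / 2 - 16 / 15 * (a3 * a2) - 4 / 15 * (a3 * b3) + 4 / 15 * (a2 * b2) + 16 / 15 * (b3 * b2)"
      unfolding X that
      by (subst pair_term_vector[of "15 / 8"])
        (simp_all add: r rr power2_eq_square algebra_simps add_divide_distrib diff_divide_distrib)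
    moreover have "pair_term (X $ i2) (X $ i4) (v $ i2) (v $ i4)
        = 4 / 15 * (b2 + b4)\<^sup>2 + (a2 + a4)\<^sup>2 / 4 - (a2 - a4)\<^sup>2 / 60"
      unfolding X that
      by (subst pair_term_vector[of "15 / 4"])
        (simp_all add: r rr power2_eq_square algebra_simps add_divide_distrib diff_divide_distrib)
    moreover have "pair_term (X $ i3) (X $ i4) (v $ i3) (v $ i4)
        = (a3\<^sup>2 + a4\<^sup>2) / 2 + 16 / 15 * (a3 * a4) + 4 / 15 * (a3 * b3) + 4 / 15 * (a4 * b4) + 16 / 15 * (b3 * b4)"
      unfolding X that
      by (subst pair_term_vector[of "15 / 8"])
        (simp_all add: r rr power2_eq_square algebra_simps add_divide_distrib diff_divide_distrib)
    ultimately show ?thesis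
      unfolding hess_form_pairs[OF D U]
      by (simp add: power2_eq_square algebra_simps add_divide_distrib diff_divide_distrib)
  qed
  have comp: "V $ i0 = vector [0, 0, 0]" "V $ i1 = vector [1 / 4, 0, r]" "V $ i2 = vector [0, - 1 / 4, - r]"
    "V $ i3 = vector [- 1 / 4, 0, r]" "V $ i4 = vector [0, 1 / 4, - r]"
    using D by (auto simp: V_def vec_eq_iff forall_3)
  have "has_morse_index E_log_conf (conf_class X) (dim (UNIV :: real set))"
  proof (rule has_morse_index_criterion[OF sph inj cross stat subspace_UNIV, of L "\<lambda>y. y *\<^sub>R V"])
    show "linear L" by (simp add: L_def z_def linear_iff algebra_simps)
    show "linear (\<lambda>y. y *\<^sub>R V)" by (simp add: linear_iff algebra_simps)
    show "range (\<lambda>y. y *\<^sub>R V) \<subseteq> tangent X"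
      using r by (auto simp: tangent_def all X comp vector_3_simps)
    show "hess_form X (y *\<^sub>R V) (y *\<^sub>R V) < 0" if "y \<noteq> 0" for y
    proof -
      have "hess_form X (y *\<^sub>R V) (y *\<^sub>R V) = - 16 / 15 * y\<^sup>2"
        by (subst form[of _ 0 0 y 0 0 "- y" y 0 0 "- y"])
          (simp_all add: comp vector_3_simps power2_eq_square)
      then show ?thesis using that by simp
    qed
    show "0 \<le> hess_form X v v" if v: "v \<in> tangent X" "L v = 0" for v
    proof -
      obtain x0 y0 z0 where v0: "v $ i0 = vector [x0, y0, z0]" by (rule vector_3_exhaust)
      obtain x1 y1 z1 where v1: "v $ i1 = vector [x1, y1, z1]" by (rule vector_3_exhaust)
      obtain x2 y2 z2 where v2: "v $ i2 = vector [x2, y2, z2]" by (rule vector_3_exhaust)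
      obtain x3 y3 z3 where v3: "v $ i3 = vector [x3, y3, z3]" by (rule vector_3_exhaust)
      obtain x4 y4 z4 where v4: "v $ i4 = vector [x4, y4, z4]" by (rule vector_3_exhaust)
      note vs = v0 v1 v2 v3 v4
      have tan: "z0 = 0" "z1 = 4 * (r * x1)" "z2 = 4 * (r * y2)" "z3 = - 4 * (r * x3)" "z4 = - 4 * (r * y4)"
        using v(1) by (simp_all add: tangent_def all X vs vector_3_simps field_simps)
      have "r * (x1 - y2 - x3 + y4) = 0"
        using v(2) by (simp add: L_def z_def vs tan algebra_simps)
      then have L0: "x1 - y2 - x3 + y4 = 0" using r by simp
      have "hess_form X v v \<ge> - (4 * x1 - 4 * y2 + - 4 * x3 - - 4 * y4)\<^sup>2 / 15"
        by (subst form[of v x0 y0 "4 * x1" y1 x2 "4 * y2" "- 4 * x3" y3 x4 "- 4 * y4"])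
          (simp_all add: vs tan vector_3_simps)
      also have "4 * x1 - 4 * y2 + - 4 * x3 - - 4 * y4 = 4 * (x1 - y2 - x3 + y4)" by simp
      finally show ?thesis unfolding L0 by simp
    qed
  qed simp_all
  then show ?thesis by simp
qed

section \<open>The regular pentagon\<close>

text \<open>The numbers \<open>c = cos 72\<close>, \<open>s = sin 72\<close>, \<open>t = sin 144\<close> (in degrees) generate a field of degree \<open>4\<close> with basis
  \<open>1, c, s, t\<close>; the polynomial identities below are decided by reducing to this basis.\<close>

lemma pentagon_multiplication_table:
  fixes c s t :: real
  assumes c: "c * c = 1 / 4 - c / 2" and s: "s * s = 3 / 4 + c / 2" and t: "t = 2 * s * c"
  shows "c * s = t / 2" "c * t = s / 2 - t / 2" "s * t = c + 1 / 4" "t * t = 1 / 2 - c / 2"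
proof -
  show cs: "c * s = t / 2" by (simp add: t)
  show ct: "c * t = s / 2 - t / 2"
  proof -
    have "c * t = 2 * s * (c * c)" by (simp add: t)
    then show ?thesis by (simp add: c cs[symmetric] algebra_simps)
  qed
  show st: "s * t = c + 1 / 4"
  proof -
    have "s * t = 2 * c * (s * s)" by (simp add: t)
    also have "\<dots> = 3 / 2 * c + c * c" by (simp add: s algebra_simps)
    finally show ?thesis by (simp add: c)
  qed
  show tt: "t * t = 1 / 2 - c / 2"
  proof -
    have "t * t = 2 * c * (s * t)" by (simp add: t)
    also have "\<dots> = 2 * (c * c) + c / 2" by (simp add: st algebra_simps)
    finally show ?thesis by (simp add: c)
  qed
qed

lemma pentagon_nondegenerate:
  fixes c s t :: real
  assumes c: "c * c = 1 / 4 - c / 2" and s: "s * s = 3 / 4 + c / 2" and t: "t = 2 * s * c"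
  shows "c \<noteq> 1" "s \<noteq> 0" "t \<noteq> 0" "- 1 / 2 - c \<noteq> c" "- 1 / 2 - c \<noteq> 1"
proof -
  show c1: "c \<noteq> 1" using c by auto
  show s0: "s \<noteq> 0"
  proof
    assume "s = 0"
    with s have "c = - 3 / 2" by simp
    with c show False by simp
  qed
  show "t \<noteq> 0" using pentagon_multiplication_table(4)[OF c s t] c1 by auto
    show "- 1 / 2 - c \<noteq> c"
    proof
      assume "- 1 / 2 - c = c"
      then have "c = - 1 / 4" by simp
      with c show False by simp
    qed
    show "- 1 / 2 - c \<noteq> 1"
    proof
      assume "- 1 / 2 - c = 1"
      then have "c = - 3 / 2" by simp
      with c show False by simp
    qed
qed

text \<open>The functions \<open>l1\<close> and \<open>l2\<close> are the real and imaginary part of the Fourier mode of frequency \<open>2\<close> of the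
  vertical displacements.\<close>

lemma pentagon_index:
  fixes c s t :: real
  assumes c: "c * c = 1 / 4 - c / 2" and s: "s * s = 3 / 4 + c / 2" and t: "t = 2 * s * c"
    and D: "distinct [i0, i1, i2, i3, i4]" and U: "UNIV = {i0, i1, i2, i3, i4}"
    and X: "X $ i0 = vector [1, 0, 0]" "X $ i1 = vector [c, s, 0]" "X $ i2 = vector [- 1 / 2 - c, t, 0]"
      "X $ i3 = vector [- 1 / 2 - c, - t, 0]" "X $ i4 = vector [c, - s, 0]"
  shows "has_morse_index E_log_conf (conf_class X) 2"
proof -
  have all: "(\<forall>i. P i) \<longleftrightarrow> P i0 \<and> P i1 \<and> P i2 \<and> P i3 \<and> P i4" for P
    using U by (metis UNIV_I insertE singletonD)
  note tab0 = pentagon_multiplication_table[OF c s t]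
  \<comment> \<open>the table in the form that rewrites right-nested products\<close>
  have tab: "c * (c * x) = (1 / 4 - c / 2) * x" "c * (s * x) = t / 2 * x" "c * (t * x) = (s / 2 - t / 2) * x"
    "s * (s * x) = (3 / 4 + c / 2) * x" "s * (t * x) = (c + 1 / 4) * x" "t * (t * x) = (1 / 2 - c / 2) * x" for x
    by (simp_all only: mult.assoc[symmetric] c s tab0)
  note tab = tab c s tab0
  note nondeg = pentagon_nondegenerate[OF c s t]
  have inv: "inverse (2 - 2 * c) = (3 + 2 * c) / 5" "inverse (3 + 2 * c) = (2 - 2 * c) / 5"
  proof -
    have "(2 - 2 * c) * ((3 + 2 * c) / 5) = 1" "(3 + 2 * c) * ((2 - 2 * c) / 5) = 1"
      by (simp_all add: c algebra_simps add_divide_distrib diff_divide_distrib)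
    then show "inverse (2 - 2 * c) = (3 + 2 * c) / 5" "inverse (3 + 2 * c) = (2 - 2 * c) / 5"
      by (metis inverse_unique)+
  qed
  have dne: "2 - 2 * c \<noteq> 0" "3 + 2 * c \<noteq> 0" using nondeg by auto
  have sph: "X \<in> sphere_tuples"
    by (simp add: sphere_tuples_def all X norm_eq_1 vector_3_simps tab algebra_simps)
  have inj: "inj (\<lambda>i. X $ i)"
    using nondeg by (intro inj_enumerated_5[OF U]) (auto simp: X vector_3_simps)
  have cross: "X $ i0 \<times> X $ i1 \<noteq> 0"
    using nondeg by (simp add: X cross3_vector vector_3_simps)
  have dist: "(X $ i0 - X $ i1) \<bullet> (X $ i0 - X $ i1) = 2 - 2 * c" "(X $ i0 - X $ i2) \<bullet> (X $ i0 - X $ i2) = 3 + 2 * c"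
    "(X $ i0 - X $ i3) \<bullet> (X $ i0 - X $ i3) = 3 + 2 * c" "(X $ i0 - X $ i4) \<bullet> (X $ i0 - X $ i4) = 2 - 2 * c"
    "(X $ i1 - X $ i2) \<bullet> (X $ i1 - X $ i2) = 2 - 2 * c" "(X $ i1 - X $ i3) \<bullet> (X $ i1 - X $ i3) = 3 + 2 * c"
    "(X $ i1 - X $ i4) \<bullet> (X $ i1 - X $ i4) = 3 + 2 * c" "(X $ i2 - X $ i3) \<bullet> (X $ i2 - X $ i3) = 2 - 2 * c"
    "(X $ i2 - X $ i4) \<bullet> (X $ i2 - X $ i4) = 3 + 2 * c" "(X $ i3 - X $ i4) \<bullet> (X $ i3 - X $ i4) = 2 - 2 * c"
    by (simp_all add: X vector_3_simps tab algebra_simps)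
  have flip: "(X $ i - X $ j) \<bullet> (X $ i - X $ j) = (X $ j - X $ i) \<bullet> (X $ j - X $ i)" for i j
    by (simp add: inner_simps inner_commute)
  note dist = dist dist[unfolded flip[of i0] flip[of i1 i2] flip[of i1 i3] flip[of i1 i4] flip[of i2 i3] flip[of i2 i4] flip[of i3 i4]]
  have stat: "stationary X"
    unfolding stationary_def all sum_enumerated_5[OF D U] dist inv
    unfolding X by (simp add: vector_3_simps tab algebra_simps add_divide_distrib diff_divide_distrib)
  define z where "z v i = v $ i $ 3" for v :: "real^3^5" and i
  define l1 where "l1 v = z v i0 + (- 1 / 2 - c) * z v i1 + c * z v i2 + c * z v i3 + (- 1 / 2 - c) * z v i4" for v
  define l2 where "l2 v = t * z v i1 - s * z v i2 + s * z v i3 - t * z v i4" for v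
  define vert where "vert b0 b1 b2 b3 b4 = ((\<chi> i. vector [0, 0, if i = i0 then b0 else if i = i1 then b1
      else if i = i2 then b2 else if i = i3 then b3 else b4]) :: real^3^5)" for b0 b1 b2 b3 b4 :: real
  define J where "J y = fst y *\<^sub>R vert 1 (- 1 / 2 - c) c c (- 1 / 2 - c) + snd y *\<^sub>R vert 0 t (- s) s (- t)"
    for y :: "real \<times> real"
  have form: "hess_form X v v
      = 2 * (((a0 - a1)\<^sup>2 + (a1 - a2)\<^sup>2 + (a2 - a3)\<^sup>2 + (a3 - a4)\<^sup>2 + (a0 - a4)\<^sup>2) / (2 - 2 * c)
            + ((a0 - a2)\<^sup>2 + (a1 - a3)\<^sup>2 + (a2 - a4)\<^sup>2 + (a0 - a3)\<^sup>2 + (a1 - a4)\<^sup>2) / (3 + 2 * c))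
        + 4 / 5 * (b0 + b1 + b2 + b3 + b4)\<^sup>2 - 4 / 5 * ((l1 v)\<^sup>2 + (l2 v)\<^sup>2)"
    if "v $ i0 = vector [- 0 * a0, 1 * a0, b0]" "v $ i1 = vector [- s * a1, c * a1, b1]"
      "v $ i2 = vector [- t * a2, (- 1 / 2 - c) * a2, b2]" "v $ i3 = vector [- (- t) * a3, (- 1 / 2 - c) * a3, b3]"
      "v $ i4 = vector [- (- s) * a4, c * a4, b4]"
    for v a0 a1 a2 a3 a4 b0 b1 b2 b3 b4
  proof -
    have near: "pair_term (X $ i0) (X $ i1) (v $ i0) (v $ i1)
        = (a0 - a1)\<^sup>2 / (2 - 2 * c) + (b0\<^sup>2 + b1\<^sup>2) / 2 - (b0 - b1)\<^sup>2 / (2 - 2 * c)"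
      "pair_term (X $ i1) (X $ i2) (v $ i1) (v $ i2)
        = (a1 - a2)\<^sup>2 / (2 - 2 * c) + (b1\<^sup>2 + b2\<^sup>2) / 2 - (b1 - b2)\<^sup>2 / (2 - 2 * c)"
      "pair_term (X $ i2) (X $ i3) (v $ i2) (v $ i3)
        = (a2 - a3)\<^sup>2 / (2 - 2 * c) + (b2\<^sup>2 + b3\<^sup>2) / 2 - (b2 - b3)\<^sup>2 / (2 - 2 * c)"
      "pair_term (X $ i3) (X $ i4) (v $ i3) (v $ i4)
        = (a3 - a4)\<^sup>2 / (2 - 2 * c) + (b3\<^sup>2 + b4\<^sup>2) / 2 - (b3 - b4)\<^sup>2 / (2 - 2 * c)"
      "pair_term (X $ i0) (X $ i4) (v $ i0) (v $ i4)
        = (a0 - a4)\<^sup>2 / (2 - 2 * c) + (b0\<^sup>2 + b4\<^sup>2) / 2 - (b0 - b4)\<^sup>2 / (2 - 2 * c)"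
      unfolding X that using dne by (intro equator_pair_term; simp add: tab algebra_simps)+
    have far: "pair_term (X $ i0) (X $ i2) (v $ i0) (v $ i2)
        = (a0 - a2)\<^sup>2 / (3 + 2 * c) + (b0\<^sup>2 + b2\<^sup>2) / 2 - (b0 - b2)\<^sup>2 / (3 + 2 * c)"
      "pair_term (X $ i1) (X $ i3) (v $ i1) (v $ i3)
        = (a1 - a3)\<^sup>2 / (3 + 2 * c) + (b1\<^sup>2 + b3\<^sup>2) / 2 - (b1 - b3)\<^sup>2 / (3 + 2 * c)"
      "pair_term (X $ i2) (X $ i4) (v $ i2) (v $ i4)
        = (a2 - a4)\<^sup>2 / (3 + 2 * c) + (b2\<^sup>2 + b4\<^sup>2) / 2 - (b2 - b4)\<^sup>2 / (3 + 2 * c)"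
      "pair_term (X $ i0) (X $ i3) (v $ i0) (v $ i3)
        = (a0 - a3)\<^sup>2 / (3 + 2 * c) + (b0\<^sup>2 + b3\<^sup>2) / 2 - (b0 - b3)\<^sup>2 / (3 + 2 * c)"
      "pair_term (X $ i1) (X $ i4) (v $ i1) (v $ i4)
        = (a1 - a4)\<^sup>2 / (3 + 2 * c) + (b1\<^sup>2 + b4\<^sup>2) / 2 - (b1 - b4)\<^sup>2 / (3 + 2 * c)"
      unfolding X that using dne by (intro equator_pair_term; simp add: tab algebra_simps)+
    have ls: "l1 v = b0 + (- 1 / 2 - c) * b1 + c * b2 + c * b3 + (- 1 / 2 - c) * b4"
      "l2 v = t * b1 - s * b2 + s * b3 - t * b4"
      unfolding l1_def l2_def z_def that by simp_all
    have "2 * (b0\<^sup>2 + b1\<^sup>2 + b2\<^sup>2 + b3\<^sup>2 + b4\<^sup>2)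
        - ((b0 - b1)\<^sup>2 + (b1 - b2)\<^sup>2 + (b2 - b3)\<^sup>2 + (b3 - b4)\<^sup>2 + (b0 - b4)\<^sup>2) / (2 - 2 * c)
        - ((b0 - b2)\<^sup>2 + (b1 - b3)\<^sup>2 + (b2 - b4)\<^sup>2 + (b0 - b3)\<^sup>2 + (b1 - b4)\<^sup>2) / (3 + 2 * c)
        = 2 / 5 * (b0 + b1 + b2 + b3 + b4)\<^sup>2 - 2 / 5 * ((l1 v)\<^sup>2 + (l2 v)\<^sup>2)"
      unfolding ls divide_inverse[of _ "2 - 2 * c"] divide_inverse[of _ "3 + 2 * c"] inv
      by (simp add: tab power2_eq_square algebra_simps add_divide_distrib diff_divide_distrib)
    then show ?thesis
      unfolding hess_form_pairs[OF D U] near far add_divide_distrib by (simp add: algebra_simps)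
  qed
  have vert: "vert b0 b1 b2 b3 b4 $ i0 = vector [0, 0, b0]" "vert b0 b1 b2 b3 b4 $ i1 = vector [0, 0, b1]"
    "vert b0 b1 b2 b3 b4 $ i2 = vector [0, 0, b2]" "vert b0 b1 b2 b3 b4 $ i3 = vector [0, 0, b3]"
    "vert b0 b1 b2 b3 b4 $ i4 = vector [0, 0, b4]" for b0 b1 b2 b3 b4
    using D by (auto simp: vert_def)
  have Jv: "J y $ i0 = vector [- 0 * 0, 1 * 0, fst y]"
    "J y $ i1 = vector [- s * 0, c * 0, fst y * (- 1 / 2 - c) + snd y * t]"
    "J y $ i2 = vector [- t * 0, (- 1 / 2 - c) * 0, fst y * c - snd y * s]"
    "J y $ i3 = vector [- (- t) * 0, (- 1 / 2 - c) * 0, fst y * c + snd y * s]"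
    "J y $ i4 = vector [- (- s) * 0, c * 0, fst y * (- 1 / 2 - c) - snd y * t]" for y
    by (simp_all add: J_def vert vector_3_simps)
  have "has_morse_index E_log_conf (conf_class X) (dim (UNIV :: (real \<times> real) set))"
  proof (rule has_morse_index_criterion[OF sph inj cross stat subspace_UNIV, of "\<lambda>v. (l1 v, l2 v)" J])
    show "linear (\<lambda>v. (l1 v, l2 v))" by (simp add: l1_def l2_def z_def linear_iff algebra_simps add_divide_distrib)
    show "linear J" by (simp add: J_def linear_iff algebra_simps)
    show "range J \<subseteq> tangent X"
      by (auto simp: tangent_def all X Jv vector_3_simps)
    show "hess_form X (J y) (J y) < 0" if "y \<noteq> 0" for y
    proof -
      have l: "l1 (J y) = 5 / 2 * fst y" "l2 (J y) = 5 / 2 * snd y"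
        by (simp_all add: l1_def l2_def z_def Jv tab algebra_simps)
      have "hess_form X (J y) (J y) = - 5 * ((fst y)\<^sup>2 + (snd y)\<^sup>2)"
        unfolding form[OF Jv] l by (simp add: power2_eq_square algebra_simps)
      moreover have "(fst y)\<^sup>2 + (snd y)\<^sup>2 > 0"
        using that by (simp add: prod_eq_iff sum_power2_gt_zero_iff)
      ultimately show ?thesis by simp
    qed
    show "0 \<le> hess_form X v v" if v: "v \<in> tangent X" "(l1 v, l2 v) = 0" for v
    proof -
      obtain x0 y0 z0 where v0: "v $ i0 = vector [x0, y0, z0]" by (rule vector_3_exhaust)
      obtain x1 y1 z1 where v1: "v $ i1 = vector [x1, y1, z1]" by (rule vector_3_exhaust)
      obtain x2 y2 z2 where v2: "v $ i2 = vector [x2, y2, z2]" by (rule vector_3_exhaust)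
      obtain x3 y3 z3 where v3: "v $ i3 = vector [x3, y3, z3]" by (rule vector_3_exhaust)
      obtain x4 y4 z4 where v4: "v $ i4 = vector [x4, y4, z4]" by (rule vector_3_exhaust)
      note vs = v0 v1 v2 v3 v4
      have tan: "x0 * 1 + y0 * 0 = 0" "x1 * c + y1 * s = 0" "x2 * (- 1 / 2 - c) + y2 * t = 0"
        "x3 * (- 1 / 2 - c) + y3 * (- t) = 0" "x4 * c + y4 * (- s) = 0"
        using v(1) by (simp_all add: tangent_def all X vs vector_3_simps)
      have n: "(1::real) * 1 + 0 * 0 = 1" "c * c + s * s = 1"
        "(- 1 / 2 - c) * (- 1 / 2 - c) + t * t = 1" "(- 1 / 2 - c) * (- 1 / 2 - c) + (- t) * (- t) = 1"
        "c * c + (- s) * (- s) = 1"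
        by (simp_all add: tab algebra_simps)
      have "\<exists>a0 a1 a2 a3 a4. v $ i0 = vector [- 0 * a0, 1 * a0, z0] \<and> v $ i1 = vector [- s * a1, c * a1, z1]
        \<and> v $ i2 = vector [- t * a2, (- 1 / 2 - c) * a2, z2] \<and> v $ i3 = vector [- (- t) * a3, (- 1 / 2 - c) * a3, z3]
        \<and> v $ i4 = vector [- (- s) * a4, c * a4, z4]"
        unfolding vs vector_3_eq_iff
        using tangent_circle[OF n(1) tan(1)] tangent_circle[OF n(2) tan(2)] tangent_circle[OF n(3) tan(3)]
          tangent_circle[OF n(4) tan(4)] tangent_circle[OF n(5) tan(5)]
        by blast
      then obtain a0 a1 a2 a3 a4 where
        "v $ i0 = vector [- 0 * a0, 1 * a0, z0]" "v $ i1 = vector [- s * a1, c * a1, z1]"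
        "v $ i2 = vector [- t * a2, (- 1 / 2 - c) * a2, z2]" "v $ i3 = vector [- (- t) * a3, (- 1 / 2 - c) * a3, z3]"
        "v $ i4 = vector [- (- s) * a4, c * a4, z4]"
        by blast
      note f = form[OF this]
      have "2 - 2 * c \<ge> 0" "3 + 2 * c \<ge> 0"
        using zero_le_square[of t] zero_le_square[of s] unfolding tab0(4) s by simp_all
      then show ?thesis unfolding f using v(2) by (simp add: prod_eq_iff)
    qed
  qed simp_all
  then show ?thesis by (simp add: numeral_2_eq_2)
qed

section \<open>Morse indices of the critical configurations\<close>

text \<open>Comparing \<open>cos (6 pi / 5) = cos (4 pi / 5)\<close> through the double and triple angle formulas gives
  \<open>(c - 1) (4 c\<^sup>2 + 2 c - 1) = 0\<close>.\<close>

lemma cos_sin_fifths: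
  defines "c \<equiv> cos (2 * pi / 5)" and "s \<equiv> sin (2 * pi / 5)"
  shows "c * c = 1 / 4 - c / 2" "s * s = 3 / 4 + c / 2"
    "cos (4 * pi / 5) = - 1 / 2 - c" "sin (4 * pi / 5) = 2 * s * c"
    "cos (6 * pi / 5) = - 1 / 2 - c" "sin (6 * pi / 5) = - (2 * s * c)"
    "cos (8 * pi / 5) = c" "sin (8 * pi / 5) = - s"
proof -
  have c4: "cos (4 * pi / 5) = 2 * c\<^sup>2 - 1" and s4: "sin (4 * pi / 5) = 2 * s * c"
    using cos_double_cos[of "2 * pi / 5"] sin_double[of "2 * pi / 5"] by (simp_all add: c_def s_def)
  have 6: "6 * pi / 5 = 2 * pi - 4 * pi / 5" and 8: "8 * pi / 5 = 2 * pi - 2 * pi / 5" by simp_all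
  have c6: "cos (6 * pi / 5) = cos (4 * pi / 5)" and s6: "sin (6 * pi / 5) = - sin (4 * pi / 5)"
    unfolding 6 by (simp_all only: cos_2pi_minus sin_2pi_minus)
  show "cos (8 * pi / 5) = c" "sin (8 * pi / 5) = - s"
    unfolding 8 c_def s_def by (simp_all only: cos_2pi_minus sin_2pi_minus)
  have "cos (6 * pi / 5) = 4 * c ^ 3 - 3 * c"
    using cos_treble_cos[of "2 * pi / 5"] by (simp add: c_def)
  then have "(c - 1) * (4 * c\<^sup>2 + 2 * c - 1) = 0"
    unfolding c6 c4 by (simp add: power2_eq_square power3_eq_cube algebra_simps)
  moreover have "c \<noteq> 1"
    using cos_monotone_0_pi[of 0 "2 * pi / 5"] by (simp add: c_def)
  ultimately have q: "4 * c\<^sup>2 + 2 * c - 1 = 0" by simp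
  then show cc: "c * c = 1 / 4 - c / 2" by (simp add: power2_eq_square)
  show "s * s = 3 / 4 + c / 2"
    using sin_cos_squared_add[of "2 * pi / 5"] cc by (simp add: c_def s_def power2_eq_square)
  show c4': "cos (4 * pi / 5) = - 1 / 2 - c" using c4 q by simp
  show "sin (4 * pi / 5) = 2 * s * c" by (rule s4)
  show "cos (6 * pi / 5) = - 1 / 2 - c" "sin (6 * pi / 5) = - (2 * s * c)"
    using c6 s6 c4' s4 by simp_all
qed

lemma has_morse_index_rotate:
  assumes "rotation_matrix R" "has_morse_index f (conf_class (act R X)) m"
  shows "has_morse_index f (conf_class X) m"
proof -
  note T = rotation_matrix_transpose[OF assms(1)]
  have "X = act (transpose R) (act R X)" by (simp add: act_act T)
  moreover have "act R X \<in> sphere_tuples"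
  proof -
    have "conf_class (act R X) \<in> Conf" using assms(2) by (simp add: has_morse_index_def)
    then obtain Y where "Y \<in> sphere_tuples" "conf_class (act R X) = conf_class Y"
      unfolding Conf_def conf_class_def by (auto elim: quotientE)
    then have "conf_class (act R X) \<noteq> {}"
      using conf_class_eq[of Y] rotation_matrix_mat_1 by auto
    then show ?thesis by (auto simp: conf_class_def rotation_rel_def)
  qed
  ultimately have "conf_class X = conf_class (act R X)" using conf_class_act[OF T(1)] by metis
  then show ?thesis using assms(2) by simp
qed

lemma morse_index_pentagon:
  assumes "is_C0 X"
  shows "has_morse_index E_log_conf (conf_class X) 2"
proof -
  obtain a b where ab: "norm a = 1" "norm b = 1" "a \<bullet> b = 0" and
    r: "range (\<lambda>i. X $ i) =
       (\<lambda>k::nat. cos (2 * pi * real k / 5) *\<^sub>R a + sin (2 * pi * real k / 5) *\<^sub>R b) ` {..<5}"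
    using assms unfolding is_C0_def by blast
  obtain R where R: "rotation_matrix R" "\<And>y. R *v y = vector [a \<bullet> y, b \<bullet> y, (a \<times> b) \<bullet> y]"
    using rotation_to_standard_frame[OF ab] by blast
  define c where "c = cos (2 * pi / 5)"
  define s where "s = sin (2 * pi / 5)"
  note cs = cos_sin_fifths[folded c_def s_def]
  have Rv: "R *v (x *\<^sub>R a + y *\<^sub>R b) = vector [x, y, 0]" for x y
    using ab by (simp add: R(2) inner_simps inner_commute[of b a] dot_cross_self norm_eq_1)
  have "range (\<lambda>i. act R X $ i) = (\<lambda>y. R *v y) ` range (\<lambda>i. X $ i)" by (simp add: image_image)
  also have "\<dots> = (\<lambda>k::nat. vector [cos (2 * pi * real k / 5), sin (2 * pi * real k / 5), 0]) ` {..<5}"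
    unfolding r by (simp only: image_image Rv)
  also have "{..<5} = {0, 1, 2, 3, 4 :: nat}" by auto
  finally have rng: "range (\<lambda>i. act R X $ i) = {vector [1, 0, 0], vector [c, s, 0],
      vector [- 1 / 2 - c, 2 * s * c, 0], vector [- 1 / 2 - c, - (2 * s * c), 0], vector [c, - s, 0]}"
    by (simp add: cs mult.commute[of pi] flip: c_def s_def)
  have "distinct [vector [1, 0, 0], vector [c, s, 0],
      vector [- 1 / 2 - c, 2 * s * c, 0], vector [- 1 / 2 - c, - (2 * s * c), 0], vector [c, - s, 0] :: real^3]"
    using pentagon_nondegenerate[OF cs(1,2) refl] by (auto simp: vector_3_eq_iff)
  from enumerate_range_5[OF rng this] obtain i0 i1 i2 i3 i4
    where D: "distinct [i0, i1, i2, i3, i4]" and U: "UNIV = {i0, i1, i2, i3, i4}"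
    and X: "act R X $ i0 = vector [1, 0, 0]" "act R X $ i1 = vector [c, s, 0]"
      "act R X $ i2 = vector [- 1 / 2 - c, 2 * s * c, 0]" "act R X $ i3 = vector [- 1 / 2 - c, - (2 * s * c), 0]"
      "act R X $ i4 = vector [c, - s, 0]" .
  show ?thesis
    by (rule has_morse_index_rotate[OF R(1) pentagon_index[OF cs(1,2) refl D U X]])
qed

lemma morse_index_pyramid:
  assumes "is_C1 X"
  shows "has_morse_index E_log_conf (conf_class X) 1"
proof -
  define r where "r = sqrt 15 / 4"
  have r: "r > 0" "r * r = 15 / 16" by (simp_all add: r_def)
  have rng: "range (\<lambda>i. X $ i) = {vector [0, 0, 1], vector [r, 0, - 1 / 4], vector [0, r, - 1 / 4],
      vector [- r, 0, - 1 / 4], vector [0, - r, - 1 / 4]}"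
    using assms by (simp add: is_C1_def r_def insert_commute)
  have "distinct [vector [0, 0, 1], vector [r, 0, - 1 / 4], vector [0, r, - 1 / 4],
      vector [- r, 0, - 1 / 4], vector [0, - r, - 1 / 4] :: real^3]"
    using r by (simp add: vector_3_eq_iff)
  from enumerate_range_5[OF rng this] show ?thesis
    using pyramid_index[OF r] by metis
qed

lemma morse_index_bipyramid:
  assumes "is_C2 X"
  shows "has_morse_index E_log_conf (conf_class X) 0"
proof -
  obtain \<theta> where r: "range (\<lambda>i. X $ i) = {vector [0, 0, 1], vector [0, 0, - 1]} \<union>
     (\<lambda>k::nat. vector [cos (\<theta> + 2 * pi * real k / 3), sin (\<theta> + 2 * pi * real k / 3), 0]) ` {..<3}"
    using assms unfolding is_C2_def by blast
  define a b :: "real^3" where "a = vector [cos \<theta>, sin \<theta>, 0]" and "b = vector [- sin \<theta>, cos \<theta>, 0]"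
  have ab: "norm a = 1" "norm b = 1" "a \<bullet> b = 0"
    by (simp_all add: a_def b_def norm_eq_1 vector_3_inner flip: power2_eq_square)
  obtain R where R: "rotation_matrix R" "\<And>y. R *v y = vector [a \<bullet> y, b \<bullet> y, (a \<times> b) \<bullet> y]"
    using rotation_to_standard_frame[OF ab] by blast
  have axb: "a \<times> b = vector [0, 0, 1]"
    by (simp add: a_def b_def cross3_vector vector_3_eq_iff flip: power2_eq_square)
  have Rv: "R *v vector [cos (\<theta> + y), sin (\<theta> + y), 0] = vector [cos y, sin y, 0]" for y
    using cos_diff[of "\<theta> + y" \<theta>] sin_diff[of "\<theta> + y" \<theta>]
    by (simp add: R(2) axb) (simp add: a_def b_def vector_3_simps algebra_simps)
  have Rz: "R *v vector [0, 0, z] = vector [0, 0, z]" for z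
    by (simp add: R(2) axb) (simp add: a_def b_def vector_3_simps)
  define h where "h = sqrt 3 / 2"
  have h: "h * h = 3 / 4" by (simp add: h_def)
  have trig: "cos (2 * pi / 3) = - 1 / 2" "sin (2 * pi / 3) = h" "cos (4 * pi / 3) = - 1 / 2" "sin (4 * pi / 3) = - h"
  proof -
    have 4: "4 * pi / 3 = 2 * pi - 2 * pi / 3" by simp
    show "cos (2 * pi / 3) = - 1 / 2" "sin (2 * pi / 3) = h"
      using cos_120 sin_120' by (simp_all add: h_def mult.commute)
    then show "cos (4 * pi / 3) = - 1 / 2" "sin (4 * pi / 3) = - h"
      unfolding 4 by (simp_all only: cos_2pi_minus sin_2pi_minus)
  qed
  have "range (\<lambda>i. act R X $ i) = (\<lambda>y. R *v y) ` range (\<lambda>i. X $ i)" by (simp add: image_image)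
  also have "\<dots> = {vector [0, 0, 1], vector [0, 0, - 1]} \<union>
     (\<lambda>k::nat. vector [cos (2 * pi * real k / 3), sin (2 * pi * real k / 3), 0]) ` {..<3}"
    unfolding r by (simp only: image_Un image_insert image_empty image_image Rv Rz)
  also have "{..<3} = {0, 1, 2 :: nat}" by auto
  finally have rng: "range (\<lambda>i. act R X $ i) = {vector [0, 0, 1], vector [0, 0, - 1], vector [1, 0, 0],
      vector [- 1 / 2, h, 0], vector [- 1 / 2, - h, 0]}"
    by (simp add: trig insert_commute)
  have "h \<noteq> 0" by (simp add: h_def)
  then have "distinct [vector [0, 0, 1], vector [0, 0, - 1], vector [1, 0, 0],
      vector [- 1 / 2, h, 0], vector [- 1 / 2, - h, 0] :: real^3]"
    by (simp add: vector_3_eq_iff)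
  from enumerate_range_5[OF rng this] obtain i0 i1 i2 i3 i4
    where D: "distinct [i0, i1, i2, i3, i4]" and U: "UNIV = {i0, i1, i2, i3, i4}"
    and X: "act R X $ i0 = vector [0, 0, 1]" "act R X $ i1 = vector [0, 0, - 1]" "act R X $ i2 = vector [1, 0, 0]"
      "act R X $ i3 = vector [- 1 / 2, h, 0]" "act R X $ i4 = vector [- 1 / 2, - h, 0]" .
  show ?thesis
    by (rule has_morse_index_rotate[OF R(1) bipyramid_index[OF h D U X]])
qed

theorem theorem6p1:
  fixes X :: "real^3^5"
  shows "(is_C0 X \<longrightarrow> has_morse_index E_log_conf (conf_class X) 2) \<and>
         (is_C1 X \<longrightarrow> has_morse_index E_log_conf (conf_class X) 1) \<and>
         (is_C2 X \<longrightarrow> has_morse_index E_log_conf (conf_class X) 0)"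
  using morse_index_pentagon morse_index_pyramid morse_index_bipyramid by blast

end
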